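(* (Power-scaling law.) Let $\gamma_k$ be the uplink zero-forcing SINR of terminal $k$ in cell $l$ under delayed channels (defined in the context), with transmit power scaled as $p_r=E/\sqrt N$, where $E>0$ is fixed regardless of $N$ (so that $p_{\mathrm{tr}}=\tau E/\sqrt N$). Then for fixed $K$, as $N\to\infty$, $$\gamma_k\to\frac{\alpha^2\tau E^2\beta_{llk}^2}{\alpha^2\tau E^2C\beta_{llk}^2+1}\quad\text{almost surely}.$$
   Context: Parameters: integers $L\ge 2$ (cells), $K\ge 1$ (terminals per cell), $N\ge K$ (base-station antennas), $\tau\ge K$ (pilot length); a cell index $l\in\{1,\dots,L\}$ and a terminal index $k\in\{1,\dots,K\}$; transmit power $p_r>0$, reals $\beta_{lij}>0$ ($1\le i\le L$, $1\le j\le K$), and a temporal correlation parameter $\alpha$ with $0<|\alpha|\le 1$; everything except $N$ and $p_r$ is fixed. Put $p_{\mathrm{tr}}=\tau p_r$, $\hat\beta_{lij}=\beta_{lij}^2/\big(\sum_{i'=1}^L\beta_{li'j}+1/p_{\mathrm{tr}}\big)$ and $C=\sum_{i\neq l}(\beta_{lik}/\beta_{llk})^2$. Channel model (for each $N$, all on a common probability space): $\mathcal{CN}(0,\Sigma)$ denotes the circularly symmetric complex Gaussian law. $\hat G_{ll}$ is an $N\times K$ complex random matrix with independent columns, the $j$th column having law $\mathcal{CN}(0,\hat\beta_{llj}I_N)$. For $i\ne l$, $\hat G_{li}=\hat G_{ll}D_i$ with $D_i=\mathrm{diag}(\beta_{li1}/\beta_{ll1},\dots,\beta_{liK}/\beta_{llK})$.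 For $i=1,\dots,L$, $\tilde E_{li}$ is an $N\times K$ complex random matrix with independent columns, the $j$th column having law $\mathcal{CN}(0,(\beta_{lij}-\alpha^2\hat\beta_{lij})I_N)$. The family $(\tilde E_{l1},\dots,\tilde E_{lL})$ is independent of $\hat G_{ll}$. SINR: with $\hat G_{ll}^\dagger=(\hat G_{ll}^H\hat G_{ll})^{-1}\hat G_{ll}^H$ (almost surely defined), $[A]_k$ the $k$th row of $A$ and $\|\cdot\|$ the Euclidean norm, $$\gamma_k=\frac{\alpha^2p_r}{\alpha^2p_r\sum_{i\ne l}\|[\hat G_{ll}^\dagger]_k\hat G_{li}\|^2+p_r\sum_{i=1}^L\|[\hat G_{ll}^\dagger]_k\tilde E_{li}\|^2+\|[\hat G_{ll}^\dagger]_k\|^2}.$$ *)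

theory Defs
  imports
    "HOL-Probability.Probability"
    "Jordan_Normal_Form.Gauss_Jordan_Elimination"
    "Jordan_Normal_Form.Determinant"
    "Jordan_Normal_Form.Schur_Decomposition"
begin

(* Cells and terminals are indexed from 0, that is by {..<L} and {..<K}, to agree with the
   indexing of rows and columns of matrices. *)

section \<open>Borel and Lebesgue structure on complex vectors and matrices of fixed size\<close>

definition vec_borel :: "nat \<Rightarrow> complex vec measure" where
  "vec_borel n = vimage_algebra (carrier_vec n) (\<lambda>v. \<lambda>i\<in>{..<n}. v $ i) (\<Pi>\<^sub>M i\<in>{..<n}. borel)"

definition mat_borel :: "nat \<Rightarrow> nat \<Rightarrow> complex mat measure" where
  "mat_borel n m = vimage_algebra (carrier_mat n m)
     (\<lambda>A. \<lambda>p\<in>{..<n} \<times> {..<m}. A $$ p) (\<Pi>\<^sub>M p\<in>{..<n} \<times> {..<m}. borel)"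

(* 2n-dimensional Lebesgue measure on C^n. *)
definition vec_lborel :: "nat \<Rightarrow> complex vec measure" where
  "vec_lborel n = distr (\<Pi>\<^sub>M i\<in>{..<n}. lborel) (vec_borel n) (Matrix.vec n)"

section \<open>The circularly symmetric complex Gaussian law\<close>

(* The value is meaningful for an invertible matrix only. *)
definition minv :: "complex mat \<Rightarrow> complex mat" where
  "minv A = the (mat_inverse A)"

(* The law CN(0,S) on C^n for a Hermitian positive definite covariance matrix S = E[z z^H]; its
   density with respect to Lebesgue measure is exp(- z^H S^-1 z) / (pi^n det S). The quadratic form
   and the determinant are real for such S. *)
definition CN :: "nat \<Rightarrow> complex mat \<Rightarrow> complex vec measure" where
  "CN n S = density (vec_lborel n)
     (\<lambda>z. ennreal (exp (- Re ((minv S *\<^sub>v z) \<bullet>c z)) / (pi ^ n * Re (Determinant.det S))))"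

definition indep_gaussian_columns ::
    "'w measure \<Rightarrow> nat \<Rightarrow> nat \<Rightarrow> (nat \<Rightarrow> complex mat) \<Rightarrow> ('w \<Rightarrow> complex mat) \<Rightarrow> bool" where
  "indep_gaussian_columns M n m S X \<longleftrightarrow>
     X \<in> M \<rightarrow>\<^sub>M mat_borel n m \<and>
     prob_space.indep_vars M (\<lambda>_. vec_borel n) (\<lambda>j \<omega>. Matrix.col (X \<omega>) j) {..<m} \<and>
     (\<forall>j<m. distr M (vec_borel n) (\<lambda>\<omega>. Matrix.col (X \<omega>) j) = CN n (S j))"

section \<open>The channel model with delayed channels\<close>

definition beta_hat :: "nat \<Rightarrow> real \<Rightarrow> (nat \<Rightarrow> nat \<Rightarrow> nat \<Rightarrow> real) \<Rightarrow> nat \<Rightarrow> nat \<Rightarrow> nat \<Rightarrow> real" where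
  "beta_hat L ptr \<beta> l i j = (\<beta> l i j)\<^sup>2 / ((\<Sum>i'<L. \<beta> l i' j) + 1 / ptr)"

definition interf_const :: "nat \<Rightarrow> (nat \<Rightarrow> nat \<Rightarrow> nat \<Rightarrow> real) \<Rightarrow> nat \<Rightarrow> nat \<Rightarrow> real" where
  "interf_const L \<beta> l k = (\<Sum>i\<in>{..<L} - {l}. (\<beta> l i k / \<beta> l l k)\<^sup>2)"

(* For a fixed number N of antennas and a fixed reference cell l, G i stands for the estimate
   G-hat_{li} and Et i for E-tilde_{li}. No independence between different Et i is required.
   indep_set of the generated sigma-algebras is used because indep_var only relates random
   variables of one type. *)
definition channel_model ::
    "'w measure \<Rightarrow> nat \<Rightarrow> nat \<Rightarrow> nat \<Rightarrow> nat \<Rightarrow> real \<Rightarrow> (nat \<Rightarrow> nat \<Rightarrow> nat \<Rightarrow> real) \<Rightarrow> real \<Rightarrow> nat \<Rightarrow>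
     (nat \<Rightarrow> 'w \<Rightarrow> complex mat) \<Rightarrow> (nat \<Rightarrow> 'w \<Rightarrow> complex mat) \<Rightarrow> bool" where
  "channel_model M L K N \<tau> pr \<beta> \<alpha> l G Et \<longleftrightarrow>
    (let ptr = real \<tau> * pr; bh = beta_hat L ptr \<beta> in
     indep_gaussian_columns M N K (\<lambda>j. complex_of_real (bh l l j) \<cdot>\<^sub>m 1\<^sub>m N) (G l) \<and>
     (\<forall>i<L. i \<noteq> l \<longrightarrow> (\<forall>\<omega>\<in>space M.
        G i \<omega> = G l \<omega> * mat_diag K (\<lambda>j. complex_of_real (\<beta> l i j / \<beta> l l j)))) \<and>
     (\<forall>i<L. indep_gaussian_columns M N K
        (\<lambda>j. complex_of_real (\<beta> l i j - \<alpha>\<^sup>2 * bh l i j) \<cdot>\<^sub>m 1\<^sub>m N) (Et i)) \<and>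
     prob_space.indep_set M
       (sets (vimage_algebra (space M) (G l) (mat_borel N K)))
       (sets (vimage_algebra (space M) (\<lambda>\<omega>. \<lambda>i\<in>{..<L}. Et i \<omega>)
          (\<Pi>\<^sub>M i\<in>{..<L}. mat_borel N K))))"

section \<open>Zero-forcing SINR\<close>

definition pinv :: "complex mat \<Rightarrow> complex mat" where
  "pinv A = minv (mat_adjoint A * A) * mat_adjoint A"

definition vnorm :: "complex vec \<Rightarrow> real" where
  "vnorm v = L2_set (\<lambda>i. cmod (v $ i)) {..<dim_vec v}"

(* The product of a row vector with a matrix. *)
definition row_mult :: "complex vec \<Rightarrow> complex mat \<Rightarrow> complex vec" where
  "row_mult v A = Matrix.transpose_mat A *\<^sub>v v"

definition sinr ::
    "nat \<Rightarrow> real \<Rightarrow> real \<Rightarrow> nat \<Rightarrow> nat \<Rightarrow> (nat \<Rightarrow> complex mat) \<Rightarrow> (nat \<Rightarrow> complex mat) \<Rightarrow> real" where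
  "sinr L pr \<alpha> l k G Et =
    (let w = Matrix.row (pinv (G l)) k in
     \<alpha>\<^sup>2 * pr /
     (\<alpha>\<^sup>2 * pr * (\<Sum>i\<in>{..<L} - {l}. (vnorm (row_mult w (G i)))\<^sup>2)
      + pr * (\<Sum>i<L. (vnorm (row_mult w (Et i)))\<^sup>2)
      + (vnorm w)\<^sup>2))"

end

(* Nothing is assumed about the joint law of the channels for different N, so almost sure
   convergence is obtained from the Borel-Cantelli lemma with exponential moments. For independent
   Gaussian columns x, y in C^N with variances c, c', the inner product x^H y is conditionally
   Gaussian given x, which gives E exp(Re (u x^H y)) = (1 - |u|^2 c c' / 4)^(-N); likewise
   E exp(t |x|^2) = (1 - t c)^(-N). Hence almost surely x^H y = O(ln N sqrt(N c c')) and
   |x|^2 = N c (1 + O(ln N / sqrt N)). For the estimated channel G the column variances are of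
   order 1 / sqrt N, so G^H G / sqrt N tends to a diagonal matrix with entries beta_llj^2 tau E, and
   G^H E_li / sqrt N tends to 0. With P = (G^H G / sqrt N)^(-1) the SINR is an explicit continuous
   function of P and of P (G^H E_li / sqrt N), because the k-th row w of the pseudoinverse satisfies
   w G = e_k and |w|^2 = P_kk / sqrt N. *)
theory Submission
  imports Defs "HOL-Real_Asymp.Real_Asymp"
begin

no_notation vec_nth (infixl "$" 90)

section \<open>Exponential moments of complex Gaussian vectors\<close>

text \<open>Second moments would be too weak for Borel-Cantelli: x^H y / sqrt N has second moment c
  c', which is of order 1 / sqrt N when only x is an estimated column, and such tail bounds are not
  summable. Exponential moments cost merely a logarithm. The exponent 1/2 in the power scaling is
  the critical one. Receiver noise therefore survives in the limit, as 1 / d_k with d_k = beta_llk^2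
  tau E. The channel error is negligible, since its inner products with estimated columns are of
  order N^(1/4) up to a logarithm, against the scale sqrt N. The interference of the other cells is
  proportional, column by column, to the estimated channel, so it passes through the receiver
  without any attenuation; this is the origin of C.\<close>

lemma nn_integral_gaussian_exp_linear:
  fixes a b :: real
  assumes "a > 0"
  shows "(\<integral>\<^sup>+x. ennreal (exp (- a * x\<^sup>2 + b * x)) \<partial>lborel) = ennreal (sqrt (pi / a) * exp (b\<^sup>2 / (4 * a)))"
proof -
  \<comment> \<open>Completing the square: up to a constant the integrand is the normal density with
    mean b / (2a) and variance 1 / (2a).\<close>
  have eq: "exp (- a * x\<^sup>2 + b * x) =
      sqrt (pi / a) * exp (b\<^sup>2 / (4 * a)) * normal_density (b / (2 * a)) (1 / sqrt (2 * a)) x" for x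
  proof -
    have "- a * x\<^sup>2 + b * x = b\<^sup>2 / (4 * a) + (- (x - b / (2 * a))\<^sup>2 / (2 * (1 / sqrt (2 * a))\<^sup>2))"
      using assms by (simp add: power_divide field_simps power2_eq_square)
    moreover have "sqrt (pi / a) * (1 / sqrt (2 * pi * (1 / sqrt (2 * a))\<^sup>2)) = 1"
      using assms by (simp add: power_divide real_sqrt_divide[symmetric])
    ultimately show ?thesis
      by (simp only: normal_density_def exp_add) (simp add: mult_ac)
  qed
  have "(\<integral>\<^sup>+x. ennreal (normal_density (b / (2 * a)) (1 / sqrt (2 * a)) x) \<partial>lborel) = 1"
    using assms by (subst nn_integral_eq_integral) auto
  then show ?thesis
    unfolding eq using assms by (simp add: ennreal_mult' nn_integral_cmult)
qed

lemma nn_integral_complex_gaussian_exp_linear: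
  fixes w :: complex
  assumes "a > 0"
  shows "(\<integral>\<^sup>+z. ennreal (exp (- a * (cmod z)\<^sup>2 + Re (w * z))) \<partial>lborel)
    = ennreal (pi / a * exp ((cmod w)\<^sup>2 / (4 * a)))"
proof -
  \<comment> \<open>\<open>Re (w * z)\<close> is the real inner product of \<open>cnj w\<close> and
    \<open>z\<close>, so the integrand factors over the basis of real and imaginary
    directions.\<close>
  let ?f = "\<lambda>e x. ennreal (exp (- a * x\<^sup>2 + (cnj w \<bullet> e) * x))"
  have "ennreal (exp (- a * (cmod z)\<^sup>2 + Re (w * z))) = (\<Prod>e\<in>Basis. ?f e (z \<bullet> e))" for z
    by (simp add: Basis_complex_def cmod_power2 ennreal_mult'[symmetric] exp_add[symmetric]
        algebra_simps inner_complex_def)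
  then have "(\<integral>\<^sup>+z. ennreal (exp (- a * (cmod z)\<^sup>2 + Re (w * z))) \<partial>lborel)
      = (\<integral>\<^sup>+z. (\<Prod>e\<in>Basis. ?f e (z \<bullet> e)) \<partial>lborel)" by simp
  also have "\<dots> = (\<Prod>e\<in>Basis. \<integral>\<^sup>+x. ?f e x \<partial>lborel)"
    by (rule nn_integral_lborel_prod) auto
  also have "\<dots> = ennreal (pi / a * exp ((cmod w)\<^sup>2 / (4 * a)))"
  proof -
    have "sqrt (pi / a) * exp ((Re w)\<^sup>2 / (4 * a)) * (sqrt (pi / a) * exp ((Im w)\<^sup>2 / (4 * a)))
        = (sqrt (pi / a) * sqrt (pi / a)) * (exp ((Re w)\<^sup>2 / (4 * a)) * exp ((Im w)\<^sup>2 / (4 * a)))"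
      by (simp only: mult_ac)
    also have "\<dots> = pi / a * exp ((cmod w)\<^sup>2 / (4 * a))"
      using assms by (simp add: cmod_power2 add_divide_distrib exp_add)
    finally show ?thesis
      unfolding nn_integral_gaussian_exp_linear[OF assms] using assms
      by (simp add: Basis_complex_def inner_complex_def flip: ennreal_mult')
  qed
  finally show ?thesis .
qed

text \<open>\<open>minv\<close> is \<open>the\<close> of an elimination result, so invertibility
  must first be certified to obtain \<open>Some\<close>; uniqueness of inverses then identifies the
  value.\<close>

lemma minv_eqI:
  assumes "A \<in> carrier_mat n n" "B \<in> carrier_mat n n" "A * B = 1\<^sub>m n"
  shows "minv A = B"
proof -
  have "B * A = 1\<^sub>m n"
    using mat_mult_left_right_inverse[OF assms] .
  then have "A \<in> Units (ring_mat TYPE(complex) n ())"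
    using assms by (auto simp: Units_def ring_mat_def)
  then obtain C where C: "mat_inverse A = Some C"
    using mat_inverse(1)[OF assms(1), of "()"] by blast
  note inv = mat_inverse(2)[OF assms(1) C]
  have "B = (C * A) * B" using inv assms by simp
  also have "\<dots> = C * (A * B)" using inv assms by (intro assoc_mult_mat) auto
  also have "\<dots> = C" using inv assms(3) right_mult_one_mat[of C n n] by simp
  finally show ?thesis by (simp add: minv_def C)
qed

lemma minv_smult_one:
  assumes "c \<noteq> 0"
  shows "minv (c \<cdot>\<^sub>m 1\<^sub>m n) = inverse c \<cdot>\<^sub>m 1\<^sub>m n"
  by (rule minv_eqI[of _ n]) (use assms in \<open>auto simp: mult_smult_assoc_mat[of _ n n] mult_smult_distrib[of _ n n]\<close>)

section \<open>Measurability of entries and columns\<close>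

lemma space_vec_borel [simp]: "space (vec_borel n) = carrier_vec n"
  by (simp add: vec_borel_def)

lemma space_mat_borel [simp]: "space (mat_borel n m) = carrier_mat n m"
  by (simp add: mat_borel_def)

lemma measurable_vec_index:
  assumes "i < n"
  shows "(\<lambda>v. v $ i) \<in> borel_measurable (vec_borel n)"
proof -
  have "(\<lambda>v. \<lambda>j\<in>{..<n}. v $ j) \<in> vec_borel n \<rightarrow>\<^sub>M (\<Pi>\<^sub>M j\<in>{..<n}. borel)"
    unfolding vec_borel_def by (rule measurable_vimage_algebra1) (simp add: space_PiM)
  from measurable_compose[OF this measurable_component_singleton[of i]] show ?thesis
    using assms by simp
qed

lemma measurable_mat_index:
  assumes "i < n" "j < m"
  shows "(\<lambda>A. A $$ (i, j)) \<in> borel_measurable (mat_borel n m)"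
proof -
  have "(\<lambda>A. \<lambda>p\<in>{..<n} \<times> {..<m}. A $$ p)
      \<in> mat_borel n m \<rightarrow>\<^sub>M (\<Pi>\<^sub>M p\<in>{..<n} \<times> {..<m}. borel)"
    unfolding mat_borel_def by (rule measurable_vimage_algebra1) (simp add: space_PiM)
  from measurable_compose[OF this measurable_component_singleton[of "(i, j)"]] show ?thesis
    using assms by simp
qed

lemma measurable_vec_borelI:
  fixes f :: "'x \<Rightarrow> complex Matrix.vec"
  assumes "\<And>x. x \<in> space M \<Longrightarrow> f x \<in> carrier_vec n"
    and "\<And>i. i < n \<Longrightarrow> (\<lambda>x. f x $ i) \<in> borel_measurable M"
  shows "f \<in> M \<rightarrow>\<^sub>M vec_borel n"
  unfolding vec_borel_def
  by (rule measurable_vimage_algebra2) (use assms in \<open>auto intro!: measurable_restrict\<close>)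

lemma measurable_col:
  assumes "j < m"
  shows "(\<lambda>A. Matrix.col A j) \<in> mat_borel n m \<rightarrow>\<^sub>M vec_borel n"
proof (rule measurable_vec_borelI)
  fix i assume "i < n"
  have "(\<lambda>A. Matrix.col A j $ i) \<in> borel_measurable (mat_borel n m) \<longleftrightarrow>
     (\<lambda>A. A $$ (i, j)) \<in> borel_measurable (mat_borel n m)"
    by (rule measurable_cong) (use assms \<open>i < n\<close> in auto)
  then show "(\<lambda>A. Matrix.col A j $ i) \<in> borel_measurable (mat_borel n m)"
    using measurable_mat_index[OF \<open>i < n\<close> assms] by simp
qed auto

lemma measurable_vec: "Matrix.vec n \<in> (\<Pi>\<^sub>M i\<in>{..<n}. lborel) \<rightarrow>\<^sub>M vec_borel n"
  by (rule measurable_vec_borelI) auto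

section \<open>Product structure and exponential moments of the Gaussian law with covariance c
  I\<close>

lemma sets_CN [simp, measurable_cong]: "sets (CN n S) = sets (vec_borel n)"
  by (simp add: CN_def vec_lborel_def)

abbreviation scalar_cov :: "nat \<Rightarrow> real \<Rightarrow> complex mat" where
  "scalar_cov n c \<equiv> complex_of_real c \<cdot>\<^sub>m 1\<^sub>m n"

text \<open>For covariance c I the quadratic form is |z|^2 / c and the determinant is c^n, so the
  density splits into one factor per coordinate.\<close>

lemma CN_scalar_cov_density:
  fixes z :: "complex Matrix.vec"
  assumes "c > 0" "z \<in> carrier_vec n"
  shows "exp (- Re ((minv (scalar_cov n c) *\<^sub>v z) \<bullet>c z)) / (pi ^ n * Re (Determinant.det (scalar_cov n c)))
    = (\<Prod>i<n. exp (- (cmod (z $ i))\<^sup>2 / c) / (pi * c))"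
proof -
  have "minv (scalar_cov n c) *\<^sub>v z = complex_of_real (inverse c) \<cdot>\<^sub>v z"
    using assms by (intro eq_vecI)
      (auto simp: minv_smult_one scalar_prod_def if_distrib[of "\<lambda>x. x * _"]
        if_distrib[of "\<lambda>x. inverse _ * x"] cong: if_cong)
  then have "(minv (scalar_cov n c) *\<^sub>v z) \<bullet>c z
      = (\<Sum>i<n. complex_of_real (inverse c) * z $ i * cnj (z $ i))"
    using assms(2) by (simp add: scalar_prod_def atLeast0LessThan)
  also have "\<dots> = (\<Sum>i<n. complex_of_real ((cmod (z $ i))\<^sup>2 / c))"
  proof (rule sum.cong)
    fix i
    show "complex_of_real (inverse c) * z $ i * cnj (z $ i) = complex_of_real ((cmod (z $ i))\<^sup>2 / c)"
      unfolding mult.assoc complex_norm_square[symmetric] by (simp add: field_simps)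
  qed simp
  finally have "Re ((minv (scalar_cov n c) *\<^sub>v z) \<bullet>c z) = (\<Sum>i<n. (cmod (z $ i))\<^sup>2 / c)"
    by (simp only: Re_complex_of_real flip: of_real_sum)
  moreover have "Re (Determinant.det (scalar_cov n c)) = c ^ n"
    by (simp flip: of_real_power)
  ultimately show ?thesis
    by (simp add: prod_dividef exp_sum power_mult_distrib flip: sum_negf)
qed

text \<open>Tonelli for the product density: the coordinates are independent. Every exponential
  moment below has an integrand of this product form.\<close>

lemma nn_integral_CN_prod:
  fixes f :: "nat \<Rightarrow> complex \<Rightarrow> ennreal"
  assumes c: "c > 0" and f: "\<And>i. i < n \<Longrightarrow> f i \<in> borel_measurable borel"
  shows "(\<integral>\<^sup>+z. (\<Prod>i<n. f i (z $ i)) \<partial>CN n (scalar_cov n c))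
    = (\<Prod>i<n. \<integral>\<^sup>+z. ennreal (exp (- (cmod z)\<^sup>2 / c) / (pi * c)) * f i z \<partial>lborel)"
proof -
  let ?d = "\<lambda>z. ennreal (exp (- (cmod z)\<^sup>2 / c) / (pi * c))"
  let ?D = "\<lambda>z. ennreal (exp (- Re ((minv (scalar_cov n c) *\<^sub>v z) \<bullet>c z)) / (pi ^ n * Re (Determinant.det (scalar_cov n c))))"
  note [measurable] = measurable_vec_index measurable_vec f
  have D: "?D z = (\<Prod>i<n. ?d (z $ i))" if "z \<in> carrier_vec n" for z
    unfolding CN_scalar_cov_density[OF c that] using c by (subst prod_ennreal) auto
  have "(\<lambda>z. \<Prod>i<n. ?d (z $ i)) \<in> borel_measurable (vec_borel n)" by measurable
  then have D_meas: "?D \<in> borel_measurable (vec_borel n)"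
    using measurable_cong[of "vec_borel n" ?D "\<lambda>z. \<Prod>i<n. ?d (z $ i)" borel] D by simp
  have F: "(\<lambda>z. \<Prod>i<n. f i (z $ i)) \<in> borel_measurable (vec_borel n)" by measurable
  have "(\<integral>\<^sup>+z. (\<Prod>i<n. f i (z $ i)) \<partial>CN n (scalar_cov n c))
     = (\<integral>\<^sup>+z. ?D z * (\<Prod>i<n. f i (z $ i)) \<partial>vec_lborel n)"
    unfolding CN_def by (rule nn_integral_density) (use D_meas F in \<open>auto simp: vec_lborel_def\<close>)
  also have "\<dots> = (\<integral>\<^sup>+x. ?D (Matrix.vec n x) * (\<Prod>i<n. f i (Matrix.vec n x $ i)) \<partial>(\<Pi>\<^sub>M i\<in>{..<n}. lborel))"
    unfolding vec_lborel_def by (rule nn_integral_distr) (use D_meas F in \<open>auto intro: measurable_vec\<close>)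
  also have "\<dots> = (\<integral>\<^sup>+x. (\<Prod>i<n. ?d (x i) * f i (x i)) \<partial>(\<Pi>\<^sub>M i\<in>{..<n}. lborel))"
    by (rule nn_integral_cong) (subst D, auto simp: prod.distrib)
  also have "\<dots> = (\<Prod>i<n. \<integral>\<^sup>+z. ?d z * f i z \<partial>lborel)"
  proof -
    interpret product_sigma_finite "\<lambda>i::nat. lborel :: complex measure" ..
    show ?thesis by (rule product_nn_integral_prod) auto
  qed
  finally show ?thesis .
qed

text \<open>The factor exp (t |z|^2) only changes the rate of the Gaussian from 1 / c to 1 / c - t,
  which is positive exactly when t c < 1. The case t = 0 serves linear exponents, the case w = 0
  quadratic ones.\<close>

lemma nn_integral_CN_density_exp:
  fixes w :: complex
  assumes c: "c > 0" and t: "t * c < 1"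
  shows "(\<integral>\<^sup>+z. ennreal (exp (- (cmod z)\<^sup>2 / c) / (pi * c)) * ennreal (exp (t * (cmod z)\<^sup>2 + Re (w * z))) \<partial>lborel)
    = ennreal (exp (c * (cmod w)\<^sup>2 / (4 * (1 - t * c))) / (1 - t * c))"
proof -
  have a: "1 / c - t > 0" using assms by (simp add: field_simps)
  have "ennreal (exp (- (cmod z)\<^sup>2 / c) / (pi * c)) * ennreal (exp (t * (cmod z)\<^sup>2 + Re (w * z)))
      = ennreal (1 / (pi * c)) * ennreal (exp (- (1 / c - t) * (cmod z)\<^sup>2 + Re (w * z)))" for z
  proof -
    have "- (1 / c - t) * (cmod z)\<^sup>2 + Re (w * z)
        = - (cmod z)\<^sup>2 / c + (t * (cmod z)\<^sup>2 + Re (w * z))"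
      using c by (simp add: field_simps)
    then have "exp (- (1 / c - t) * (cmod z)\<^sup>2 + Re (w * z))
        = exp (- (cmod z)\<^sup>2 / c) * exp (t * (cmod z)\<^sup>2 + Re (w * z))"
      by (simp only: exp_add)
    then show ?thesis
      using c by (simp del: times_complex.simps flip: ennreal_mult')
  qed
  moreover have "1 / (pi * c) * (pi / (1 / c - t) * exp ((cmod w)\<^sup>2 / (4 * (1 / c - t))))
      = exp (c * (cmod w)\<^sup>2 / (4 * (1 - t * c))) / (1 - t * c)"
  proof -
    have "1 / c - t = (1 - t * c) / c" using c by (simp add: field_simps)
    then show ?thesis using c by (simp add: mult.commute)
  qed
  moreover have "(\<integral>\<^sup>+z. ennreal (1 / (pi * c)) * ennreal (exp (- (1 / c - t) * (cmod z)\<^sup>2 + Re (w * z))) \<partial>lborel)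
      = ennreal (1 / (pi * c) * (pi / (1 / c - t) * exp ((cmod w)\<^sup>2 / (4 * (1 / c - t)))))"
    using c by (subst nn_integral_cmult, simp)
      (simp only: nn_integral_complex_gaussian_exp_linear[OF a], simp flip: ennreal_mult')
  ultimately show ?thesis by (simp only:)
qed

lemma nn_integral_CN_exp_linear:
  fixes w :: "nat \<Rightarrow> complex"
  assumes c: "c > 0"
  shows "(\<integral>\<^sup>+z. ennreal (exp (Re (\<Sum>i<n. w i * z $ i))) \<partial>CN n (scalar_cov n c))
    = ennreal (exp (c / 4 * (\<Sum>i<n. (cmod (w i))\<^sup>2)))"
proof -
  have "(\<integral>\<^sup>+z. ennreal (exp (Re (\<Sum>i<n. w i * z $ i))) \<partial>CN n (scalar_cov n c))
     = (\<integral>\<^sup>+z. (\<Prod>i<n. (\<lambda>x. ennreal (exp (Re (w i * x)))) (z $ i)) \<partial>CN n (scalar_cov n c))"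
    by (simp add: Re_sum exp_sum prod_ennreal del: times_complex.simps)
  also have "\<dots> = (\<Prod>i<n. ennreal (exp (c * (cmod (w i))\<^sup>2 / 4)))"
    using nn_integral_CN_density_exp[OF c, of 0]
    by (subst nn_integral_CN_prod[OF c]) (auto simp del: times_complex.simps)
  also have "\<dots> = ennreal (exp (c / 4 * (\<Sum>i<n. (cmod (w i))\<^sup>2)))"
    by (simp add: prod_ennreal exp_sum sum_distrib_left)
  finally show ?thesis .
qed

lemma nn_integral_CN_exp_quadratic:
  assumes c: "c > 0" and t: "t * c < 1"
  shows "(\<integral>\<^sup>+z. ennreal (exp (t * (\<Sum>i<n. (cmod (z $ i))\<^sup>2))) \<partial>CN n (scalar_cov n c))
    = ennreal ((1 / (1 - t * c)) ^ n)"
proof -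
  have "(\<integral>\<^sup>+z. ennreal (exp (t * (\<Sum>i<n. (cmod (z $ i))\<^sup>2))) \<partial>CN n (scalar_cov n c))
     = (\<integral>\<^sup>+z. (\<Prod>i<n. (\<lambda>x. ennreal (exp (t * (cmod x)\<^sup>2))) (z $ i)) \<partial>CN n (scalar_cov n c))"
    by (simp add: sum_distrib_left exp_sum prod_ennreal)
  also have "\<dots> = (\<Prod>i<n. ennreal (1 / (1 - t * c)))"
    using nn_integral_CN_density_exp[OF c t, of 0]
    by (subst nn_integral_CN_prod[OF c]) auto
  finally show ?thesis using t by (simp add: ennreal_power)
qed

section \<open>Almost sure rates for inner products of Gaussian vectors\<close>

lemma measurable_inner_vec:
  fixes X Y :: "'x \<Rightarrow> complex Matrix.vec"
  assumes "X \<in> M \<rightarrow>\<^sub>M vec_borel n" "Y \<in> M \<rightarrow>\<^sub>M vec_borel n"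
  shows "(\<lambda>x. \<Sum>i<n. cnj (X x $ i) * Y x $ i) \<in> borel_measurable M"
  by (intro borel_measurable_sum borel_measurable_times
        measurable_compose[OF _ borel_measurable_continuous_onI[OF continuous_on_cnj[OF continuous_on_id]]]
        measurable_compose[OF assms(1) measurable_vec_index]
        measurable_compose[OF assms(2) measurable_vec_index]) auto

context prob_space
begin

text \<open>The threshold 2 ln n is chosen because exp (2 ln n) = n^2: a bounded exponential moment
  gives, by Markov, the summable tail bound C / n^2. Each \<open>X n\<close> enters only through its
  own law.\<close>

lemma AE_eventually_le_2ln:
  fixes X :: "nat \<Rightarrow> 'a \<Rightarrow> real"
  assumes X: "\<And>n. n \<ge> n0 \<Longrightarrow> X n \<in> borel_measurable M"
    and mgf: "\<And>n. n \<ge> n0 \<Longrightarrow> (\<integral>\<^sup>+\<omega>. ennreal (exp (X n \<omega>)) \<partial>M) \<le> ennreal C"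
  shows "AE \<omega> in M. eventually (\<lambda>n. X n \<omega> \<le> 2 * ln (real n)) sequentially"
proof -
  define m where "m = max n0 1"
  \<comment> \<open>The event is empty below \<open>m\<close>, so that it is measurable for every n,
    as Borel-Cantelli requires.\<close>
  define A where "A n = (if n \<ge> m then {\<omega> \<in> space M. X n \<omega> > 2 * ln (real n)} else {})" for n
  have A: "A n \<in> sets M" for n
    using X[of n] by (auto simp: A_def m_def)
  \<comment> \<open>A negative \<open>C\<close> would make \<open>ennreal C\<close> zero; a
    nonnegative majorant lets products pass through \<open>ennreal\<close>.\<close>
  obtain D where D: "C \<le> D" "0 \<le> D" by (metis linear order_refl)
  have bound: "measure M (A n) \<le> D * inverse (real n ^ 2)" if n: "n \<ge> m" for n
  proof -
    have n1: "n \<ge> n0" "n \<ge> 1" using n by (auto simp: m_def)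
    note X[OF n1(1), measurable]
    have "A n \<subseteq> {\<omega> \<in> space M. 1 \<le> ennreal (inverse (real n ^ 2)) * ennreal (exp (X n \<omega>))}"
    proof
      fix \<omega> assume "\<omega> \<in> A n"
      then have \<omega>: "\<omega> \<in> space M" "2 * ln (real n) < X n \<omega>" using n by (auto simp: A_def)
      have "real n ^ 2 = exp (2 * ln (real n))"
        using n1 by (simp add: exp_double)
      also have "\<dots> \<le> exp (X n \<omega>)" using \<omega>(2) by simp
      finally have "1 \<le> inverse (real n ^ 2) * exp (X n \<omega>)"
        using n1 by (simp add: field_simps)
      then show "\<omega> \<in> {\<omega> \<in> space M. 1 \<le> ennreal (inverse (real n ^ 2)) * ennreal (exp (X n \<omega>))}"
        using \<omega>(1) by (simp flip: ennreal_mult' ennreal_1)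
    qed
    then have "emeasure M (A n)
        \<le> emeasure M {\<omega> \<in> space M. 1 \<le> ennreal (inverse (real n ^ 2)) * ennreal (exp (X n \<omega>))}"
      by (rule emeasure_mono) measurable
    also have "\<dots> \<le> ennreal (inverse (real n ^ 2))
        * (\<integral>\<^sup>+\<omega>. ennreal (exp (X n \<omega>)) * indicator (space M) \<omega> \<partial>M)"
      by (rule nn_integral_Markov_inequality) auto
    also have "(\<integral>\<^sup>+\<omega>. ennreal (exp (X n \<omega>)) * indicator (space M) \<omega> \<partial>M)
        = (\<integral>\<^sup>+\<omega>. ennreal (exp (X n \<omega>)) \<partial>M)"
      by (rule nn_integral_cong) auto
    also have "ennreal (inverse (real n ^ 2)) * \<dots> \<le> ennreal (inverse (real n ^ 2)) * ennreal (D)"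
      using mgf[OF n1(1)] by (intro mult_left_mono) (auto intro: order_trans ennreal_leI D)
    finally have "emeasure M (A n) \<le> ennreal (D * inverse (real n ^ 2))"
      using D by (simp add: mult.commute flip: ennreal_mult)
    then show ?thesis
      using D by (simp add: emeasure_eq_measure)
  qed
  have "summable (\<lambda>n. measure M (A n))"
  proof (rule summable_comparison_test')
    show "summable (\<lambda>n. D * inverse (real n ^ 2))"
      by (intro summable_mult inverse_power_summable) auto
    show "norm (measure M (A n)) \<le> D * inverse (real n ^ 2)" if "n \<ge> m" for n
      using bound[OF that] by simp
  qed
  then have "AE \<omega> in M. eventually (\<lambda>n. \<omega> \<in> space M - A n) sequentially"
    by (intro borel_cantelli_AE1 A) (auto simp: emeasure_eq_measure)
  then show ?thesis
  proof eventually_elim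
    case (elim \<omega>)
    then show ?case
      using eventually_ge_at_top[of m] by eventually_elim (auto simp: A_def not_less split: if_splits)
  qed
qed

section \<open>From independence of families and generated sigma-algebras to pairs of
  columns\<close>

lemma indep_var_of_indep_vars:
  assumes "indep_vars S X I" "i \<in> I" "j \<in> I" "i \<noteq> j"
  shows "indep_var (S i) (X i) (S j) (X j)"
  unfolding indep_var_eq
proof (intro conjI indep_setI)
  let ?F = "\<lambda>i. sigma_sets (space M) {X i -` A \<inter> space M |A. A \<in> sets (S i)}"
  have rv: "random_variable (S i) (X i)" if "i \<in> I" for i
    using assms(1) that by (auto simp: indep_vars_def)
  show "random_variable (S i) (X i)" "random_variable (S j) (X j)" using rv assms by auto
  have F: "indep_sets ?F I" using assms(1) by (simp add: indep_vars_def)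
  then show "?F i \<subseteq> events" "?F j \<subseteq> events" using assms by (auto simp: indep_sets_def)
  fix a b assume "a \<in> ?F i" "b \<in> ?F j"
  then show "prob (a \<inter> b) = prob a * prob b"
    using indep_setsD[OF F, of "{i, j}" "\<lambda>x. if x = i then a else b"] assms
    by (auto simp: Int_commute)
qed

text \<open>A function of X generates a sub-sigma-algebra of that of X, so independence is
  inherited. This brings the independence of the whole estimate and the whole error family down to
  single columns.\<close>

lemma indep_var_of_indep_set_vimage:
  assumes indep: "indep_set (sets (vimage_algebra (space M) X S)) (sets (vimage_algebra (space M) Y T))"
    and X: "random_variable S X" and Y: "random_variable T Y"
    and f: "f \<in> S \<rightarrow>\<^sub>M S'" and g: "g \<in> T \<rightarrow>\<^sub>M T'"
  shows "indep_var S' (\<lambda>\<omega>. f (X \<omega>)) T' (\<lambda>\<omega>. g (Y \<omega>))"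
proof -
  have sub: "sigma_sets (space M) {(\<lambda>\<omega>. h (Z \<omega>)) -` A \<inter> space M |A. A \<in> sets U'}
      \<subseteq> sets (vimage_algebra (space M) Z U)"
    if Z: "random_variable U Z" and h: "h \<in> U \<rightarrow>\<^sub>M U'" for Z U h U'
  proof -
    have "(\<lambda>\<omega>. h (Z \<omega>)) \<in> vimage_algebra (space M) Z U \<rightarrow>\<^sub>M U'"
      using measurable_space[OF Z] by (intro measurable_compose[OF measurable_vimage_algebra1 h]) auto
    from measurable_sets[OF this]
    have "{(\<lambda>\<omega>. h (Z \<omega>)) -` A \<inter> space M |A. A \<in> sets U'} \<subseteq> sets (vimage_algebra (space M) Z U)"
      by auto
    then show ?thesis
      using sets.sigma_sets_subset[of _ "vimage_algebra (space M) Z U"] by simp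
  qed
  note sX = sub[OF X f] and sY = sub[OF Y g]
  show ?thesis
    unfolding indep_var_eq
  proof (intro conjI indep_setI)
    show "random_variable S' (\<lambda>\<omega>. f (X \<omega>))" "random_variable T' (\<lambda>\<omega>. g (Y \<omega>))"
      using measurable_compose[OF X f] measurable_compose[OF Y g] by auto
  next
    fix a b
    assume "a \<in> sigma_sets (space M) {(\<lambda>\<omega>. f (X \<omega>)) -` A \<inter> space M |A. A \<in> sets S'}"
      "b \<in> sigma_sets (space M) {(\<lambda>\<omega>. g (Y \<omega>)) -` A \<inter> space M |A. A \<in> sets T'}"
    then show "prob (a \<inter> b) = prob a * prob b"
      using indep_setD[OF indep] sX sY by blast
  qed (use sX sY indep_setD_ev1[OF indep] indep_setD_ev2[OF indep] in blast)+
qed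

lemma nn_integral_exp_inner_CN:
  fixes u :: complex
  assumes indep: "indep_var (vec_borel n) X (vec_borel n) Y"
    and X: "distr M (vec_borel n) X = CN n (scalar_cov n c)" and c: "c > 0"
    and Y: "distr M (vec_borel n) Y = CN n (scalar_cov n c')" and c': "c' > 0"
    and u: "(cmod u)\<^sup>2 * c * c' < 4"
  shows "(\<integral>\<^sup>+\<omega>. ennreal (exp (Re (u * (\<Sum>i<n. cnj (X \<omega> $ i) * Y \<omega> $ i)))) \<partial>M)
    = ennreal ((1 / (1 - (cmod u)\<^sup>2 * c * c' / 4)) ^ n)"
proof -
  let ?f = "\<lambda>(x, y). ennreal (exp (Re (u * (\<Sum>i<n. cnj (x $ i) * y $ i))))"
  \<comment> \<open>Integrating out y for fixed x leaves exp (\<open>?t\<close> |x|^2), and the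
    hypothesis on \<open>u\<close> says that \<open>?t * c < 1\<close>.\<close>
  let ?t = "(cmod u)\<^sup>2 * c' / 4"
  have "(\<lambda>p. \<Sum>i<n. cnj (fst p $ i) * snd p $ i) \<in> borel_measurable (vec_borel n \<Otimes>\<^sub>M vec_borel n)"
    by (rule measurable_inner_vec[OF measurable_fst measurable_snd])
  then have f: "?f \<in> borel_measurable (vec_borel n \<Otimes>\<^sub>M vec_borel n)"
    unfolding case_prod_beta by measurable
  have rv: "random_variable (vec_borel n) X" "random_variable (vec_borel n) Y"
    and joint: "distr M (vec_borel n \<Otimes>\<^sub>M vec_borel n) (\<lambda>\<omega>. (X \<omega>, Y \<omega>))
      = CN n (scalar_cov n c) \<Otimes>\<^sub>M CN n (scalar_cov n c')"
    using indep unfolding indep_var_distribution_eq X Y by auto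
  \<comment> \<open>Tonelli needs a sigma-finite second factor. That the density \<open>CN\<close>
    has total mass one is read off from its being the law of Y.\<close>
  interpret Y: prob_space "CN n (scalar_cov n c')"
    unfolding Y[symmetric] by (rule prob_space_distr) (rule rv)
  have "(\<integral>\<^sup>+\<omega>. ennreal (exp (Re (u * (\<Sum>i<n. cnj (X \<omega> $ i) * Y \<omega> $ i)))) \<partial>M)
      = (\<integral>\<^sup>+p. ?f p \<partial>distr M (vec_borel n \<Otimes>\<^sub>M vec_borel n) (\<lambda>\<omega>. (X \<omega>, Y \<omega>)))"
    by (subst nn_integral_distr[OF measurable_Pair[OF rv]]) (use f in simp, simp only: prod.case)
  also have "\<dots> = (\<integral>\<^sup>+x. \<integral>\<^sup>+y. ?f (x, y) \<partial>CN n (scalar_cov n c') \<partial>CN n (scalar_cov n c))"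
    unfolding joint by (rule Y.nn_integral_fst[symmetric]) (use f in measurable)
  also have "\<dots> = (\<integral>\<^sup>+x. ennreal (exp (?t * (\<Sum>i<n. (cmod (x $ i))\<^sup>2))) \<partial>CN n (scalar_cov n c))"
  proof (rule nn_integral_cong)
    fix x
    have "(\<integral>\<^sup>+y. ?f (x, y) \<partial>CN n (scalar_cov n c'))
        = (\<integral>\<^sup>+y. ennreal (exp (Re (\<Sum>i<n. (u * cnj (x $ i)) * y $ i))) \<partial>CN n (scalar_cov n c'))"
      by (simp only: prod.case sum_distrib_left mult.assoc)
    also have "\<dots> = ennreal (exp (c' / 4 * (\<Sum>i<n. (cmod (u * cnj (x $ i)))\<^sup>2)))"
      by (rule nn_integral_CN_exp_linear[OF c'])
    also have "c' / 4 * (\<Sum>i<n. (cmod (u * cnj (x $ i)))\<^sup>2) = ?t * (\<Sum>i<n. (cmod (x $ i))\<^sup>2)"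
      by (simp add: norm_mult power_mult_distrib mult_ac flip: sum_distrib_left)
    finally show "(\<integral>\<^sup>+y. ?f (x, y) \<partial>CN n (scalar_cov n c'))
        = ennreal (exp (?t * (\<Sum>i<n. (cmod (x $ i))\<^sup>2)))" .
  qed
  also have "\<dots> = ennreal ((1 / (1 - ?t * c)) ^ n)"
    by (rule nn_integral_CN_exp_quadratic[OF c]) (use u in \<open>simp add: mult_ac\<close>)
  finally show ?thesis by (simp add: mult_ac)
qed

text \<open>The logarithmic bound is one-sided and real, so it is applied to Re (v S) for four unit
  directions v. The constant 4 comes from the bound 2 for the real part and 2 for the imaginary
  part.\<close>

lemma AE_inner_CN_bound:
  fixes c c' :: "nat \<Rightarrow> real"
  assumes indep: "\<And>n. n \<ge> n0 \<Longrightarrow> indep_var (vec_borel n) (X n) (vec_borel n) (Y n)"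
    and X: "\<And>n. n \<ge> n0 \<Longrightarrow> distr M (vec_borel n) (X n) = CN n (scalar_cov n (c n))"
    and Y: "\<And>n. n \<ge> n0 \<Longrightarrow> distr M (vec_borel n) (Y n) = CN n (scalar_cov n (c' n))"
    and c: "\<And>n. n \<ge> n0 \<Longrightarrow> c n > 0" and c': "\<And>n. n \<ge> n0 \<Longrightarrow> c' n > 0"
  shows "AE \<omega> in M. eventually (\<lambda>n. cmod (\<Sum>i<n. cnj (X n \<omega> $ i) * Y n \<omega> $ i)
    \<le> 4 * ln (real n) * sqrt (real n * c n * c' n)) sequentially"
proof -
  define S where "S n \<omega> = (\<Sum>i<n. cnj (X n \<omega> $ i) * Y n \<omega> $ i)" for n \<omega>
  \<comment> \<open>The standard deviation of the inner product: for u = v / s the quantity |u|^2 c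
    c' equals 1 / n, which keeps the n-th power in the exponential moment bounded.\<close>
  define s where "s n = sqrt (real n * c n * c' n)" for n
  define m where "m = max n0 1"
  have s: "s n > 0" "(s n)\<^sup>2 = real n * c n * c' n" if "n \<ge> m" for n
    using that c[of n] c'[of n] by (auto simp: m_def s_def)
  have dir: "AE \<omega> in M. eventually (\<lambda>n. Re (v * S n \<omega>) \<le> 2 * ln (real n) * s n) sequentially"
    if v: "cmod v = 1" for v
  proof -
    have "AE \<omega> in M. eventually (\<lambda>n. Re (v / complex_of_real (s n) * S n \<omega>) \<le> 2 * ln (real n)) sequentially"
    proof (rule AE_eventually_le_2ln[of m])
      fix n assume n: "n \<ge> m"
      then have n': "n \<ge> n0" "n \<ge> 1" by (auto simp: m_def)
      note sn = s[OF n]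
      from indep[OF n'(1)] have "random_variable (vec_borel n) (X n)" "random_variable (vec_borel n) (Y n)"
        by (auto simp: indep_var_eq)
      from measurable_inner_vec[OF this] have [measurable]: "random_variable borel (S n)"
        unfolding S_def .
      show "random_variable borel (\<lambda>\<omega>. Re (v / complex_of_real (s n) * S n \<omega>))" by measurable
      have u: "(cmod (v / complex_of_real (s n)))\<^sup>2 * c n * c' n = 1 / real n"
        using v sn c[OF n'(1)] c'[OF n'(1)] n' by (simp add: norm_divide power_divide)
      have "(\<integral>\<^sup>+\<omega>. ennreal (exp (Re (v / complex_of_real (s n) * S n \<omega>))) \<partial>M)
          = ennreal ((1 / (1 - (cmod (v / complex_of_real (s n)))\<^sup>2 * c n * c' n / 4)) ^ n)"
        unfolding S_def
      proof (rule nn_integral_exp_inner_CN[OF indep[OF n'(1)] X[OF n'(1)] c[OF n'(1)] Y[OF n'(1)] c'[OF n'(1)]])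
        show "(cmod (v / complex_of_real (s n)))\<^sup>2 * c n * c' n < 4"
          unfolding u using n' by (simp add: field_simps)
      qed
      also have "(1 / (1 - (cmod (v / complex_of_real (s n)))\<^sup>2 * c n * c' n / 4)) ^ n
          = (1 / (1 - 1 / real n / 4)) ^ n"
        by (simp only: u)
      \<comment> \<open>Bernoulli gives (1 - 1 / (4n))^n \<ge> 1 - 1/4, uniformly in n.\<close>
      also have "(1 / (1 - 1 / real n / 4)) ^ n \<le> 4 / 3"
      proof -
        have "1 + real n * (- (1 / real n / 4)) \<le> (1 + - (1 / real n / 4)) ^ n"
          by (rule Bernoulli_inequality) (use n' in \<open>simp add: field_simps\<close>)
        then have "3 / 4 \<le> (1 - 1 / real n / 4) ^ n" using n' by simp
        then have "inverse ((1 - 1 / real n / 4) ^ n) \<le> inverse (3 / 4)"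
          by (rule le_imp_inverse_le) simp
        then show ?thesis by (simp add: power_one_over inverse_eq_divide)
      qed
      finally show "(\<integral>\<^sup>+\<omega>. ennreal (exp (Re (v / complex_of_real (s n) * S n \<omega>))) \<partial>M) \<le> ennreal (4 / 3)"
        by (simp add: ennreal_leI)
    qed
    then show ?thesis
    proof eventually_elim
      case (elim \<omega>)
      then show ?case using eventually_ge_at_top[of m]
      proof eventually_elim
        case (elim n)
        have "Re (v * S n \<omega>) = s n * Re (v / complex_of_real (s n) * S n \<omega>)"
        proof -
          have "v * S n \<omega> = complex_of_real (s n) * (v / complex_of_real (s n) * S n \<omega>)"
            using s[OF elim(2)] by simp
          then show ?thesis by (metis Re_complex_of_real mult_zero_left Im_complex_of_real times_complex.simps(1) diff_zero)
        qed
        then show ?case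
          using mult_left_mono[OF elim(1), of "s n"] s[OF elim(2)] by (simp add: mult_ac)
      qed
    qed
  qed
  \<comment> \<open>The directions -i and i pick out the imaginary part and its negative.\<close>
  have "AE \<omega> in M. eventually (\<lambda>n. Re (S n \<omega>) \<le> 2 * ln (real n) * s n) sequentially"
    "AE \<omega> in M. eventually (\<lambda>n. - Re (S n \<omega>) \<le> 2 * ln (real n) * s n) sequentially"
    "AE \<omega> in M. eventually (\<lambda>n. Im (S n \<omega>) \<le> 2 * ln (real n) * s n) sequentially"
    "AE \<omega> in M. eventually (\<lambda>n. - Im (S n \<omega>) \<le> 2 * ln (real n) * s n) sequentially"
    using dir[of 1] dir[of "-1"] dir[of "-\<i>"] dir[of "\<i>"] by simp_all
  then have "AE \<omega> in M. eventually (\<lambda>n. cmod (S n \<omega>) \<le> 4 * ln (real n) * s n) sequentially"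
  proof eventually_elim
    case (elim \<omega>)
    then show ?case
    proof eventually_elim
      case (elim n)
      then show ?case using cmod_le[of "S n \<omega>"] by linarith
    qed
  qed
  then show ?thesis unfolding S_def s_def .
qed

lemma AE_norm_CN_bound:
  fixes c :: "nat \<Rightarrow> real"
  assumes rv: "\<And>n. n \<ge> n0 \<Longrightarrow> random_variable (vec_borel n) (X n)"
    and X: "\<And>n. n \<ge> n0 \<Longrightarrow> distr M (vec_borel n) (X n) = CN n (scalar_cov n (c n))"
    and c: "\<And>n. n \<ge> n0 \<Longrightarrow> c n > 0"
  shows "AE \<omega> in M. eventually (\<lambda>n. \<bar>(\<Sum>i<n. (cmod (X n \<omega> $ i))\<^sup>2) - real n * c n\<bar>
    \<le> 4 * ln (real n) * sqrt (real n) * c n) sequentially"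
proof -
  define S where "S n \<omega> = (\<Sum>i<n. (cmod (X n \<omega> $ i))\<^sup>2)" for n \<omega>
  define m where "m = max n0 1"
  have dir: "AE \<omega> in M. eventually (\<lambda>n. r * (S n \<omega> - real n * c n) \<le> 4 * ln (real n) * sqrt (real n) * c n) sequentially"
    if r: "\<bar>r\<bar> = 1" for r
  proof -
    \<comment> \<open>The fluctuation of |x|^2 is of order c sqrt n, hence a parameter of order 1 /
      sqrt n. The factor 1/2 keeps |t| \<le> 1/2, where the logarithm estimate below holds, and
      undoing it turns the threshold 2 ln n into 4 ln n sqrt n.\<close>
    define t where "t n = r / (2 * sqrt (real n))" for n
    have "AE \<omega> in M. eventually (\<lambda>n. t n / c n * (S n \<omega> - real n * c n) \<le> 2 * ln (real n)) sequentially"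
    proof (rule AE_eventually_le_2ln[of m])
      fix n assume n: "n \<ge> m"
      then have n': "n \<ge> n0" "n \<ge> 1" by (auto simp: m_def)
      note cn = c[OF n'(1)]
      have t: "\<bar>t n\<bar> \<le> 1 / 2" "(t n)\<^sup>2 = 1 / (4 * real n)"
        using r n' by (auto simp: t_def power_divide power2_eq_square field_simps abs_mult abs_if split: if_splits)
      have sq: "(\<lambda>x. \<Sum>i<n. (cmod (x $ i))\<^sup>2) \<in> borel_measurable (vec_borel n)"
      proof -
        have [measurable]: "(\<lambda>x. x $ i) \<in> borel_measurable (vec_borel n)" if "i \<in> {..<n}" for i
          using measurable_vec_index that by simp
        show ?thesis by measurable
      qed
      have [measurable]: "random_variable borel (S n)"
        unfolding S_def by (rule measurable_compose[OF rv[OF n'(1)] sq])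
      show "random_variable borel (\<lambda>\<omega>. t n / c n * (S n \<omega> - real n * c n))" by measurable
      have meas: "(\<lambda>x. ennreal (exp (t n / c n * (\<Sum>i<n. (cmod (x $ i))\<^sup>2)))) \<in> borel_measurable (vec_borel n)"
        using sq by measurable
      have "(\<integral>\<^sup>+\<omega>. ennreal (exp (t n / c n * (S n \<omega> - real n * c n))) \<partial>M)
          = (\<integral>\<^sup>+\<omega>. ennreal (exp (- t n * real n)) * ennreal (exp (t n / c n * S n \<omega>)) \<partial>M)"
        using cn by (intro nn_integral_cong) (simp add: field_simps flip: ennreal_mult' exp_add)
      also have "\<dots> = ennreal (exp (- t n * real n)) * (\<integral>\<^sup>+\<omega>. ennreal (exp (t n / c n * S n \<omega>)) \<partial>M)"
        by (rule nn_integral_cmult) measurable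
      also have "(\<integral>\<^sup>+\<omega>. ennreal (exp (t n / c n * S n \<omega>)) \<partial>M)
          = (\<integral>\<^sup>+x. ennreal (exp (t n / c n * (\<Sum>i<n. (cmod (x $ i))\<^sup>2))) \<partial>distr M (vec_borel n) (X n))"
        unfolding S_def by (subst nn_integral_distr[OF rv[OF n'(1)]]) (use meas in simp_all)
      also have "\<dots> = ennreal ((1 / (1 - t n / c n * c n)) ^ n)"
        unfolding X[OF n'(1)] by (rule nn_integral_CN_exp_quadratic[OF cn]) (use cn t in auto)
      also have "ennreal (exp (- t n * real n)) * \<dots> = ennreal ((exp (- t n) / (1 - t n)) ^ n)"
      proof -
        have "exp (- t n * real n) = exp (- t n) ^ n"
          using exp_of_nat_mult[of n "- t n"] by (simp only: mult.commute)
        then show ?thesis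
          using cn t(1) by (simp add: power_divide flip: ennreal_mult')
      qed
      \<comment> \<open>Centring cancels the first-order term of - ln (1 - t). What remains is at
        most 2 t^2 per coordinate, in total 2 n t^2 = 1/2.\<close>
      also have "(exp (- t n) / (1 - t n)) ^ n \<le> (exp (2 * (t n)\<^sup>2)) ^ n"
      proof (rule power_mono)
        have "\<bar>ln (1 + (- t n)) - (- t n)\<bar> \<le> 2 * (- t n)\<^sup>2"
          by (rule abs_ln_one_plus_x_minus_x_bound) (use t in simp)
        then have "- t n - 2 * (t n)\<^sup>2 \<le> ln (1 - t n)" by simp
        then have "exp (- t n - 2 * (t n)\<^sup>2) \<le> 1 - t n"
          using t(1) by (subst (asm) ln_ge_iff) auto
        then have "exp (- t n) \<le> exp (2 * (t n)\<^sup>2) * (1 - t n)"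
          by (simp add: exp_diff pos_divide_le_eq mult.commute)
        then show "exp (- t n) / (1 - t n) \<le> exp (2 * (t n)\<^sup>2)"
          using t(1) by (simp add: pos_divide_le_eq)
      qed (use t in auto)
      also have "(exp (2 * (t n)\<^sup>2)) ^ n = exp (1 / 2)"
        using n' by (simp add: t(2) flip: exp_of_nat_mult)
      finally show "(\<integral>\<^sup>+\<omega>. ennreal (exp (t n / c n * (S n \<omega> - real n * c n))) \<partial>M) \<le> ennreal (exp (1 / 2))"
        by (simp add: ennreal_leI)
    qed
    then show ?thesis
    proof eventually_elim
      case (elim \<omega>)
      then show ?case using eventually_ge_at_top[of m]
      proof eventually_elim
        case (elim n)
        then have n': "n \<ge> n0" "n \<ge> 1" by (auto simp: m_def)
        have "r * (S n \<omega> - real n * c n) = 2 * sqrt (real n) * c n * (t n / c n * (S n \<omega> - real n * c n))"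
          using c[OF n'(1)] n' by (simp add: t_def)
        then show ?case
          using mult_left_mono[OF elim(1), of "2 * sqrt (real n) * c n"] c[OF n'(1)] by (simp add: mult_ac)
      qed
    qed
  qed
  have "AE \<omega> in M. eventually (\<lambda>n. S n \<omega> - real n * c n \<le> 4 * ln (real n) * sqrt (real n) * c n) sequentially"
    "AE \<omega> in M. eventually (\<lambda>n. - (S n \<omega> - real n * c n) \<le> 4 * ln (real n) * sqrt (real n) * c n) sequentially"
    using dir[of 1] dir[of "-1"] by simp_all
  then have "AE \<omega> in M. eventually (\<lambda>n. \<bar>S n \<omega> - real n * c n\<bar> \<le> 4 * ln (real n) * sqrt (real n) * c n) sequentially"
  proof eventually_elim
    case (elim \<omega>)
    then show ?case by eventually_elim linarith
  qed
  then show ?thesis unfolding S_def .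
qed

text \<open>It suffices that one of the two variances decays like 1 / sqrt n. This covers two
  estimated columns as well as an estimated column paired with an error column.\<close>

lemma AE_inner_CN_scaled_tendsto_0:
  fixes c c' :: "nat \<Rightarrow> real"
  assumes indep: "\<And>n. n \<ge> n0 \<Longrightarrow> indep_var (vec_borel n) (X n) (vec_borel n) (Y n)"
    and X: "\<And>n. n \<ge> n0 \<Longrightarrow> distr M (vec_borel n) (X n) = CN n (scalar_cov n (c n))"
    and Y: "\<And>n. n \<ge> n0 \<Longrightarrow> distr M (vec_borel n) (Y n) = CN n (scalar_cov n (c' n))"
    and c: "\<And>n. n \<ge> n0 \<Longrightarrow> c n > 0" and c': "\<And>n. n \<ge> n0 \<Longrightarrow> c' n > 0"
    and bound: "\<And>n. n \<ge> n0 \<Longrightarrow> c n \<le> a / sqrt (real n)" "\<And>n. n \<ge> n0 \<Longrightarrow> c' n \<le> b"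
  shows "AE \<omega> in M. (\<lambda>n. (\<Sum>i<n. cnj (X n \<omega> $ i) * Y n \<omega> $ i) / complex_of_real (sqrt (real n))) \<longlonglongrightarrow> 0"
proof -
  have "AE \<omega> in M. eventually (\<lambda>n. cmod (\<Sum>i<n. cnj (X n \<omega> $ i) * Y n \<omega> $ i)
    \<le> 4 * ln (real n) * sqrt (real n * c n * c' n)) sequentially"
    by (rule AE_inner_CN_bound[of n0]) (use assms in auto)
  then show ?thesis
  proof eventually_elim
    case (elim \<omega>)
    \<comment> \<open>This is 4 ln n / n^(1/4), kept in the unsimplified shape that matches the
      bound below.\<close>
    have "(\<lambda>n. 4 * ln (real n) * sqrt (real n * (1 / sqrt (real n))) / sqrt (real n)) \<longlonglongrightarrow> 0"
      by real_asymp
    from tendsto_mult_right_zero[OF this, of "sqrt (a * b)"]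
    have lim: "(\<lambda>n. sqrt (a * b) * (4 * ln (real n) * sqrt (real n * (1 / sqrt (real n))) / sqrt (real n))) \<longlonglongrightarrow> 0" .
    show ?case
    proof (rule Lim_null_comparison[OF _ lim])
      show "eventually (\<lambda>n. norm ((\<Sum>i<n. cnj (X n \<omega> $ i) * Y n \<omega> $ i) / complex_of_real (sqrt (real n)))
         \<le> sqrt (a * b) * (4 * ln (real n) * sqrt (real n * (1 / sqrt (real n))) / sqrt (real n))) sequentially"
        using elim eventually_ge_at_top[of "max n0 1"]
      proof eventually_elim
        case (elim n)
        then have n: "n \<ge> n0" "n \<ge> 1" by auto
        have "c n * c' n \<le> (a / sqrt (real n)) * b"
          using c[OF n(1)] c'[OF n(1)] bound(1)[OF n(1)] bound(2)[OF n(1)] by (intro mult_mono) auto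
        then have "real n * (c n * c' n) \<le> real n * ((a / sqrt (real n)) * b)"
          by (intro mult_left_mono) auto
        then have "sqrt (real n * c n * c' n) \<le> sqrt (a * b * (real n * (1 / sqrt (real n))))"
          by (simp add: mult_ac)
        then have "4 * ln (real n) * sqrt (real n * c n * c' n)
            \<le> 4 * ln (real n) * (sqrt (a * b) * sqrt (real n * (1 / sqrt (real n))))"
          using n unfolding real_sqrt_mult[symmetric] by (intro mult_left_mono) auto
        with elim(1) have "cmod (\<Sum>i<n. cnj (X n \<omega> $ i) * Y n \<omega> $ i)
            \<le> 4 * ln (real n) * (sqrt (a * b) * sqrt (real n * (1 / sqrt (real n))))" by linarith
        then show ?case
          using n by (simp add: norm_divide divide_right_mono mult_ac)
      qed
    qed
  qed
qed

lemma AE_norm_CN_scaled_tendsto: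
  fixes c :: "nat \<Rightarrow> real"
  assumes rv: "\<And>n. n \<ge> n0 \<Longrightarrow> random_variable (vec_borel n) (X n)"
    and X: "\<And>n. n \<ge> n0 \<Longrightarrow> distr M (vec_borel n) (X n) = CN n (scalar_cov n (c n))"
    and c: "\<And>n. n \<ge> n0 \<Longrightarrow> c n > 0"
    and lim: "(\<lambda>n. sqrt (real n) * c n) \<longlonglongrightarrow> d"
  shows "AE \<omega> in M. (\<lambda>n. (\<Sum>i<n. (cmod (X n \<omega> $ i))\<^sup>2) / sqrt (real n)) \<longlonglongrightarrow> d"
proof -
  have "AE \<omega> in M. eventually (\<lambda>n. \<bar>(\<Sum>i<n. (cmod (X n \<omega> $ i))\<^sup>2) - real n * c n\<bar>
    \<le> 4 * ln (real n) * sqrt (real n) * c n) sequentially"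
    by (rule AE_norm_CN_bound[of n0]) (use assms in auto)
  then show ?thesis
  proof eventually_elim
    case (elim \<omega>)
    \<comment> \<open>The error bound divided by sqrt n is 4 ln n c, that is, this null sequence
      times the convergent sequence sqrt n c.\<close>
    have "(\<lambda>n. 4 * ln (real n) / sqrt (real n)) \<longlonglongrightarrow> 0"
      by real_asymp
    from tendsto_mult[OF this lim]
    have lim0: "(\<lambda>n. 4 * ln (real n) / sqrt (real n) * (sqrt (real n) * c n)) \<longlonglongrightarrow> 0" by simp
    have "(\<lambda>n. (\<Sum>i<n. (cmod (X n \<omega> $ i))\<^sup>2) / sqrt (real n) - sqrt (real n) * c n) \<longlonglongrightarrow> 0"
    proof (rule Lim_null_comparison[OF _ lim0])
      show "eventually (\<lambda>n. norm ((\<Sum>i<n. (cmod (X n \<omega> $ i))\<^sup>2) / sqrt (real n) - sqrt (real n) * c n)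
         \<le> 4 * ln (real n) / sqrt (real n) * (sqrt (real n) * c n)) sequentially"
        using elim eventually_ge_at_top[of 1]
      proof eventually_elim
        case (elim n)
        have "(\<Sum>i<n. (cmod (X n \<omega> $ i))\<^sup>2) / sqrt (real n) - sqrt (real n) * c n
            = ((\<Sum>i<n. (cmod (X n \<omega> $ i))\<^sup>2) - real n * c n) / sqrt (real n)"
          using elim(2) by (simp add: diff_divide_distrib real_div_sqrt flip: times_divide_eq_left)
        then have "norm ((\<Sum>i<n. (cmod (X n \<omega> $ i))\<^sup>2) / sqrt (real n) - sqrt (real n) * c n)
            = \<bar>(\<Sum>i<n. (cmod (X n \<omega> $ i))\<^sup>2) - real n * c n\<bar> / sqrt (real n)"
          by (simp only: real_norm_def abs_divide) simp
        also have "\<dots> \<le> 4 * ln (real n) * sqrt (real n) * c n / sqrt (real n)"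
          using elim(1) by (rule divide_right_mono) simp
        finally show ?case by (simp only: times_divide_eq_left mult.assoc)
      qed
    qed
    from tendsto_add[OF this lim] show ?case by simp
  qed
qed

end

section \<open>The zero-forcing receiver\<close>

lemma tendsto_det:
  fixes A :: "'x \<Rightarrow> complex mat"
  assumes A: "\<And>x. A x \<in> carrier_mat K K" and B: "B \<in> carrier_mat K K"
    and lim: "\<And>i j. i < K \<Longrightarrow> j < K \<Longrightarrow> ((\<lambda>x. A x $$ (i, j)) \<longlongrightarrow> B $$ (i, j)) F"
  shows "((\<lambda>x. Determinant.det (A x)) \<longlongrightarrow> Determinant.det B) F"
  unfolding Determinant.det_def'[OF A] Determinant.det_def'[OF B]
proof (intro tendsto_sum tendsto_mult tendsto_const tendsto_prod)
  fix p i assume "p \<in> {p. p permutes {0..<K}}" "i \<in> {0..<K}"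
  then have "p i < K" "i < K" using permutes_in_image[of p "{0..<K}" i] by auto
  then show "((\<lambda>x. A x $$ (i, p i)) \<longlongrightarrow> B $$ (i, p i)) F" by (intro lim)
qed

lemma tendsto_adj_mat:
  fixes A :: "'x \<Rightarrow> complex mat"
  assumes A: "\<And>x. A x \<in> carrier_mat K K" and B: "B \<in> carrier_mat K K"
    and lim: "\<And>i j. i < K \<Longrightarrow> j < K \<Longrightarrow> ((\<lambda>x. A x $$ (i, j)) \<longlongrightarrow> B $$ (i, j)) F"
    and ij: "i < K" "j < K"
  shows "((\<lambda>x. adj_mat (A x) $$ (i, j)) \<longlongrightarrow> adj_mat B $$ (i, j)) F"
proof -
  have "((\<lambda>x. Determinant.det (mat_delete (A x) j i)) \<longlongrightarrow> Determinant.det (mat_delete B j i)) F"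
  proof (rule tendsto_det)
    show "mat_delete (A x) j i \<in> carrier_mat (K - 1) (K - 1)" for x
      using A[of x] by (simp add: mat_delete_def)
    show "mat_delete B j i \<in> carrier_mat (K - 1) (K - 1)"
      using B by (simp add: mat_delete_def)
    fix a b assume "a < K - 1" "b < K - 1"
    moreover from this have "Suc a < K" "Suc b < K" by auto
    ultimately show "((\<lambda>x. mat_delete (A x) j i $$ (a, b)) \<longlongrightarrow> mat_delete B j i $$ (a, b)) F"
      using A B by (auto simp: mat_delete_def carrier_matD[OF A] intro!: lim)
  qed
  then show ?thesis
    using ij B by (auto simp: adj_mat_def cofactor_def carrier_matD[OF A] intro!: tendsto_mult)
qed

lemma minv_eq_adj_mat:
  assumes "A \<in> carrier_mat n n" "Determinant.det A \<noteq> 0"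
  shows "minv A = (1 / Determinant.det A) \<cdot>\<^sub>m adj_mat A"
  using assms adj_mat[OF assms(1)]
  by (intro minv_eqI[of _ n]) (auto simp: mult_smult_distrib[of _ n n] intro!: eq_matI)

text \<open>By Cramer's rule the inverse is a quotient of polynomials in the entries, continuous
  where the determinant is nonzero. The first conclusion ensures that \<open>minv\<close> is
  eventually a genuine inverse.\<close>

lemma tendsto_minv_diag:
  fixes A :: "'x \<Rightarrow> complex mat"
  assumes A: "\<And>x. A x \<in> carrier_mat K K"
    and lim: "\<And>i j. i < K \<Longrightarrow> j < K \<Longrightarrow> ((\<lambda>x. A x $$ (i, j)) \<longlongrightarrow> (if i = j then d j else 0)) F"
    and d: "\<And>i. i < K \<Longrightarrow> d i \<noteq> 0"
  shows "eventually (\<lambda>x. Determinant.det (A x) \<noteq> 0) F"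
    and "\<And>i j. i < K \<Longrightarrow> j < K \<Longrightarrow> ((\<lambda>x. minv (A x) $$ (i, j)) \<longlongrightarrow> (if i = j then 1 / d j else 0)) F"
proof -
  let ?B = "mat_diag K d"
  have limB: "((\<lambda>x. A x $$ (i, j)) \<longlongrightarrow> ?B $$ (i, j)) F" if "i < K" "j < K" for i j
    using lim[OF that] that by (simp add: mat_diag_def)
  have minvB: "minv ?B = mat_diag K (\<lambda>i. 1 / d i)"
  proof (rule minv_eqI[of _ K])
    show "mat_diag K d * mat_diag K (\<lambda>i. 1 / d i) = 1\<^sub>m K"
      unfolding mat_diag_diag using d by (intro eq_matI) (auto simp: mat_diag_def)
  qed auto
  have "Determinant.det ?B = (\<Prod>i<K. d i)"
    by (subst Determinant.det_upper_triangular[of _ K])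
       (auto simp: mat_diag_def diag_mat_def prod.list_conv_set_nth atLeast0LessThan)
  then have detB: "Determinant.det ?B \<noteq> 0" using d by simp
  have det: "((\<lambda>x. Determinant.det (A x)) \<longlongrightarrow> Determinant.det ?B) F"
    by (rule tendsto_det[OF A _ limB]) auto
  then show ev: "eventually (\<lambda>x. Determinant.det (A x) \<noteq> 0) F"
    using detB by (rule tendsto_imp_eventually_ne)
  fix i j assume ij: "i < K" "j < K"
  have "((\<lambda>x. 1 / Determinant.det (A x) * adj_mat (A x) $$ (i, j))
      \<longlongrightarrow> 1 / Determinant.det ?B * adj_mat ?B $$ (i, j)) F"
    using detB by (intro tendsto_mult tendsto_divide tendsto_const det tendsto_adj_mat[OF A _ limB] ij) auto
  moreover have "eventually (\<lambda>x. 1 / Determinant.det (A x) * adj_mat (A x) $$ (i, j) = minv (A x) $$ (i, j)) F"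
    using ev by eventually_elim
      (use ij in \<open>simp add: minv_eq_adj_mat[OF A] carrier_matD[OF adj_mat(1)[OF A]]\<close>)
  ultimately have "((\<lambda>x. minv (A x) $$ (i, j)) \<longlongrightarrow> 1 / Determinant.det ?B * adj_mat ?B $$ (i, j)) F"
    by (rule Lim_transform_eventually)
  \<comment> \<open>The limit is read back as the inverse of the diagonal matrix, so its adjugate
    need not be computed.\<close>
  also have "1 / Determinant.det ?B * adj_mat ?B $$ (i, j) = minv ?B $$ (i, j)"
    using ij detB adj_mat(1)[of ?B K] by (simp add: minv_eq_adj_mat[of _ K])
  also have "\<dots> = (if i = j then 1 / d j else 0)"
    unfolding minvB using ij by (simp add: mat_diag_def)
  finally show "((\<lambda>x. minv (A x) $$ (i, j)) \<longlongrightarrow> (if i = j then 1 / d j else 0)) F" .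
qed

section \<open>Algebra of the zero-forcing receiver for one realisation\<close>

definition col_inner :: "complex mat \<Rightarrow> complex mat \<Rightarrow> nat \<Rightarrow> nat \<Rightarrow> complex" where
  "col_inner A B i j = (\<Sum>n<dim_row A. cnj (A $$ (n, i)) * B $$ (n, j))"

text \<open>As \<open>col_inner A B\<close> gives the entries of A^H B, this is G^H G / s. With s =
  sqrt N it has a nondegenerate limit.\<close>

definition gram :: "real \<Rightarrow> complex mat \<Rightarrow> complex mat" where
  "gram s G = Matrix.mat (dim_col G) (dim_col G) (\<lambda>(i, j). col_inner G G i j / complex_of_real s)"

lemma index_mat_adjoint:
  assumes "i < dim_col A" "j < dim_row A"
  shows "mat_adjoint A $$ (i, j) = cnj (A $$ (j, i))"
  using assms by (simp add: mat_adjoint_def mat_of_rows_index)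

lemma mat_adjoint_carrier:
  "A \<in> carrier_mat n m \<Longrightarrow> mat_adjoint (A :: complex mat) \<in> carrier_mat m n"
  by (auto simp: mat_adjoint_def)

locale zero_forcing =
  fixes G :: "complex mat" and N K k :: nat and s :: real
  assumes G: "G \<in> carrier_mat N K" and k: "k < K" and s: "s > 0"
    and det: "Determinant.det (gram s G) \<noteq> 0"
begin

abbreviation P :: "complex mat" where "P \<equiv> minv (gram s G)"

abbreviation w :: "complex Matrix.vec" where "w \<equiv> Matrix.row (pinv G) k"

lemma gram_carrier: "gram s G \<in> carrier_mat K K"
  using G by (simp add: gram_def)

lemma P_carrier: "P \<in> carrier_mat K K"
  using adj_mat(1)[OF gram_carrier] by (simp add: minv_eq_adj_mat[OF gram_carrier det])

lemma P_gram: "P * gram s G = 1\<^sub>m K" "gram s G * P = 1\<^sub>m K"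
  using adj_mat[OF gram_carrier] det gram_carrier
  by (auto simp: minv_eq_adj_mat[OF gram_carrier det] mult_smult_distrib[of _ K K]
      mult_smult_assoc_mat[of _ K K] intro!: eq_matI)

lemma minv_adjoint_mult: "minv (mat_adjoint G * G) = complex_of_real (1 / s) \<cdot>\<^sub>m P"
proof (rule minv_eqI[of _ K])
  have "mat_adjoint G * G = complex_of_real s \<cdot>\<^sub>m gram s G"
    using G mat_adjoint_carrier[OF G] s
    by (intro eq_matI) (auto simp: gram_def col_inner_def scalar_prod_def index_mat_adjoint atLeast0LessThan)
  then show "mat_adjoint G * G * (complex_of_real (1 / s) \<cdot>\<^sub>m P) = 1\<^sub>m K"
    using s P_carrier gram_carrier
    by (auto simp: mult_smult_distrib[of _ K K] mult_smult_assoc_mat[of _ K K] P_gram intro!: eq_matI)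
  show "mat_adjoint G * G \<in> carrier_mat K K"
    using mult_carrier_mat[OF mat_adjoint_carrier[OF G] G] .
qed (use P_carrier in auto)

lemma dim_col_pinv: "dim_col (pinv G) = N"
  using G mat_adjoint_carrier[OF G] by (simp add: pinv_def)

lemma w_index:
  assumes "n < N"
  shows "w $ n = (\<Sum>m<K. P $$ (k, m) * cnj (G $$ (n, m))) / complex_of_real s"
proof -
  have "w $ n = (\<Sum>m<K. complex_of_real (1 / s) * P $$ (k, m) * cnj (G $$ (n, m)))"
    using G mat_adjoint_carrier[OF G] P_carrier assms k
    by (simp add: pinv_def minv_adjoint_mult scalar_prod_def index_mat_adjoint atLeast0LessThan)
  then show ?thesis
    by (simp add: sum_divide_distrib)
qed

text \<open>Reassociation of (P G^H / s) H as P (G^H H / s): a sum over N antennas becomes a sum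
  over K scaled inner products, whose limits are known.\<close>

lemma sum_w_mult:
  "(\<Sum>n<N. w $ n * H $$ (n, j)) = (\<Sum>m<K. P $$ (k, m) * (col_inner G H m j / complex_of_real s))"
proof -
  have "(\<Sum>n<N. w $ n * H $$ (n, j))
      = (\<Sum>n<N. \<Sum>m<K. P $$ (k, m) * (cnj (G $$ (n, m)) * H $$ (n, j) / complex_of_real s))"
    by (intro sum.cong) (auto simp: w_index sum_distrib_left sum_distrib_right sum_divide_distrib mult_ac)
  also have "\<dots> = (\<Sum>m<K. \<Sum>n<N. P $$ (k, m) * (cnj (G $$ (n, m)) * H $$ (n, j) / complex_of_real s))"
    by (rule sum.swap)
  finally show ?thesis
    using G by (simp add: col_inner_def sum_distrib_left sum_divide_distrib)
qed

lemma row_mult_index: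
  assumes "H \<in> carrier_mat N K'" "j < K'"
  shows "row_mult w H $ j = (\<Sum>m<K. P $$ (k, m) * (col_inner G H m j / complex_of_real s))"
  unfolding sum_w_mult[symmetric] using assms
  by (simp add: row_mult_def scalar_prod_def dim_col_pinv atLeast0LessThan mult.commute)

lemma vnorm_row_mult:
  assumes "H \<in> carrier_mat N K'"
  shows "(vnorm (row_mult w H))\<^sup>2
    = (\<Sum>j<K'. (cmod (\<Sum>m<K. P $$ (k, m) * (col_inner G H m j / complex_of_real s)))\<^sup>2)"
proof -
  have "dim_vec (row_mult w H) = K'" using assms by (simp add: row_mult_def)
  then show ?thesis
    by (simp add: vnorm_def L2_set_def sum_nonneg row_mult_index[OF assms])
qed

lemma P_col_inner:
  assumes "j < K"
  shows "(\<Sum>m<K. P $$ (k, m) * (col_inner G G m j / complex_of_real s)) = (if j = k then 1 else 0)"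
proof -
  have "(\<Sum>m<K. P $$ (k, m) * (col_inner G G m j / complex_of_real s)) = (P * gram s G) $$ (k, j)"
    using P_carrier gram_carrier G assms k
    by (simp add: scalar_prod_def atLeast0LessThan) (simp add: gram_def)
  then show ?thesis using assms k by (simp add: P_gram)
qed

text \<open>From w G = e_k follows w G D = r_k e_k, so the interference term is an exact constant
  for every N, not merely in the limit.\<close>

lemma vnorm_row_mult_diag:
  "(vnorm (row_mult w (G * mat_diag K (\<lambda>j. complex_of_real (r j)))))\<^sup>2 = (r k)\<^sup>2"
proof -
  let ?H = "G * mat_diag K (\<lambda>j. complex_of_real (r j))"
  have H: "?H \<in> carrier_mat N K" using G by auto
  have "(\<Sum>m<K. P $$ (k, m) * (col_inner G ?H m j / complex_of_real s))
      = (if j = k then complex_of_real (r j) else 0)" if "j < K" for j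
  proof -
    have "col_inner G ?H m j = col_inner G G m j * complex_of_real (r j)" for m
      using that G by (simp add: mat_diag_mult_right[OF G] col_inner_def sum_distrib_right mult.assoc)
    then have "(\<Sum>m<K. P $$ (k, m) * (col_inner G ?H m j / complex_of_real s))
        = (\<Sum>m<K. P $$ (k, m) * (col_inner G G m j / complex_of_real s)) * complex_of_real (r j)"
      by (simp add: sum_distrib_right mult.assoc)
    then show ?thesis unfolding P_col_inner[OF that] by simp
  qed
  then have "(vnorm (row_mult w ?H))\<^sup>2 = (\<Sum>j<K. if j = k then (r j)\<^sup>2 else 0)"
    unfolding vnorm_row_mult[OF H] by (intro sum.cong) auto
  then show ?thesis using k by simp
qed

lemma vnorm_w: "(vnorm w)\<^sup>2 = Re (P $$ (k, k)) / s"
proof -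
  have "complex_of_real ((vnorm w)\<^sup>2) = (\<Sum>n<N. w $ n * cnj (w $ n))"
    by (simp add: vnorm_def L2_set_def sum_nonneg dim_col_pinv complex_norm_square flip: of_real_power)
  \<comment> \<open>Only the conjugated factor is expanded; the other one is kept so that w G = e_k
    collapses the sum to m = k. Taking real parts at the end avoids showing that the diagonal entry
    of \<open>P\<close> is real.\<close>
  also have "\<dots> = (\<Sum>n<N. \<Sum>m<K. cnj (P $$ (k, m)) / complex_of_real s * (w $ n * G $$ (n, m)))"
  proof (intro sum.cong refl)
    fix n assume "n \<in> {..<N}"
    then have "cnj (w $ n) = (\<Sum>m<K. cnj (P $$ (k, m)) * G $$ (n, m)) / complex_of_real s"
      by (simp add: w_index)
    then show "w $ n * cnj (w $ n) = (\<Sum>m<K. cnj (P $$ (k, m)) / complex_of_real s * (w $ n * G $$ (n, m)))"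
      by (simp only:) (simp add: sum_distrib_left sum_divide_distrib mult_ac)
  qed
  also have "\<dots> = (\<Sum>m<K. \<Sum>n<N. cnj (P $$ (k, m)) / complex_of_real s * (w $ n * G $$ (n, m)))"
    by (rule sum.swap)
  also have "\<dots> = (\<Sum>m<K. cnj (P $$ (k, m)) / complex_of_real s * (if m = k then 1 else 0))"
    by (rule sum.cong) (simp_all only: sum_distrib_left[symmetric] sum_w_mult P_col_inner lessThan_iff)
  also have "\<dots> = cnj (P $$ (k, k)) / complex_of_real s"
    using k by (simp add: if_distrib cong: if_cong)
  finally have "Re (complex_of_real ((vnorm w)\<^sup>2)) = Re (cnj (P $$ (k, k)) / complex_of_real s)"
    by (rule arg_cong)
  then show ?thesis by (simp only: Re_complex_of_real Re_divide_of_real cnj.simps)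
qed

text \<open>The numerator and all three terms of the denominator carry a common factor 1 / s, from
  the power E / s or from the formula for |w|^2. After it cancels, N enters only through quantities
  that converge.\<close>

lemma sinr_eq:
  assumes l: "l < L" and Gs: "Gs l = G"
    and Gi: "\<And>i. i < L \<Longrightarrow> i \<noteq> l \<Longrightarrow> Gs i = G * mat_diag K (\<lambda>j. complex_of_real (r i j))"
    and Et: "\<And>i. i < L \<Longrightarrow> Et i \<in> carrier_mat N K"
  shows "sinr L (E / s) \<alpha> l k Gs Et = \<alpha>\<^sup>2 * E /
    (\<alpha>\<^sup>2 * E * (\<Sum>i\<in>{..<L} - {l}. (r i k)\<^sup>2)
     + E * (\<Sum>i<L. \<Sum>j<K. (cmod (\<Sum>m<K. P $$ (k, m) * (col_inner G (Et i) m j / complex_of_real s)))\<^sup>2)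
     + Re (P $$ (k, k)))"
proof -
  have "(\<Sum>i\<in>{..<L} - {l}. (vnorm (row_mult w (Gs i)))\<^sup>2) = (\<Sum>i\<in>{..<L} - {l}. (r i k)\<^sup>2)"
    by (intro sum.cong) (auto simp: Gi vnorm_row_mult_diag)
  moreover have "(\<Sum>i<L. (vnorm (row_mult w (Et i)))\<^sup>2)
      = (\<Sum>i<L. \<Sum>j<K. (cmod (\<Sum>m<K. P $$ (k, m) * (col_inner G (Et i) m j / complex_of_real s)))\<^sup>2)"
    by (intro sum.cong) (auto simp: vnorm_row_mult[OF Et])
  ultimately have "sinr L (E / s) \<alpha> l k Gs Et = \<alpha>\<^sup>2 * (E / s) /
    (\<alpha>\<^sup>2 * (E / s) * (\<Sum>i\<in>{..<L} - {l}. (r i k)\<^sup>2)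
     + (E / s) * (\<Sum>i<L. \<Sum>j<K. (cmod (\<Sum>m<K. P $$ (k, m) * (col_inner G (Et i) m j / complex_of_real s)))\<^sup>2)
     + Re (P $$ (k, k)) / s)"
    unfolding sinr_def Let_def Gs vnorm_w by (simp only:)
  also have "\<dots> = (\<alpha>\<^sup>2 * E / s) / ((\<alpha>\<^sup>2 * E * (\<Sum>i\<in>{..<L} - {l}. (r i k)\<^sup>2)
     + E * (\<Sum>i<L. \<Sum>j<K. (cmod (\<Sum>m<K. P $$ (k, m) * (col_inner G (Et i) m j / complex_of_real s)))\<^sup>2)
     + Re (P $$ (k, k))) / s)"
    by (simp only: add_divide_distrib times_divide_eq_left times_divide_eq_right)
  finally show ?thesis using s by simp
qed

end

text \<open>The deterministic half of the argument, applied to one fixed outcome: the probabilistic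
  input is confined to \<open>limG\<close> and \<open>limE\<close>.\<close>

lemma sinr_tendsto:
  fixes G Et :: "nat \<Rightarrow> nat \<Rightarrow> complex mat" and d :: "nat \<Rightarrow> real"
  assumes k: "k < K" and l: "l < L" and E: "E > 0" and d: "\<And>j. j < K \<Longrightarrow> d j > 0"
    and G: "\<And>N. N \<ge> K \<Longrightarrow> G N l \<in> carrier_mat N K"
    and Gi: "\<And>N i. N \<ge> K \<Longrightarrow> i < L \<Longrightarrow> i \<noteq> l \<Longrightarrow> G N i = G N l * mat_diag K (\<lambda>j. complex_of_real (r i j))"
    and Et: "\<And>N i. N \<ge> K \<Longrightarrow> i < L \<Longrightarrow> Et N i \<in> carrier_mat N K"
    and limG: "\<And>i j. i < K \<Longrightarrow> j < K \<Longrightarrow>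
      (\<lambda>N. col_inner (G N l) (G N l) i j / complex_of_real (sqrt (real N)))
        \<longlonglongrightarrow> (if i = j then complex_of_real (d j) else 0)"
    and limE: "\<And>i m j. i < L \<Longrightarrow> m < K \<Longrightarrow> j < K \<Longrightarrow>
      (\<lambda>N. col_inner (G N l) (Et N i) m j / complex_of_real (sqrt (real N))) \<longlonglongrightarrow> 0"
  shows "(\<lambda>N. sinr L (E / sqrt (real N)) \<alpha> l k (G N) (Et N)) \<longlonglongrightarrow>
    \<alpha>\<^sup>2 * E / (\<alpha>\<^sup>2 * E * (\<Sum>i\<in>{..<L} - {l}. (r i k)\<^sup>2) + 1 / d k)"
proof -
  \<comment> \<open>The size of \<open>A N\<close> is K by K for every N, whereas
    \<open>gram\<close> takes its size from the channel matrix, which is controlled only for N \<ge>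
    K.\<close>
  define A where "A N = Matrix.mat K K (\<lambda>(i, j). col_inner (G N l) (G N l) i j / complex_of_real (sqrt (real N)))" for N
  have A: "A N \<in> carrier_mat K K" for N by (simp add: A_def)
  have A_gram: "A N = gram (sqrt (real N)) (G N l)" if "N \<ge> K" for N
    using G[OF that] by (simp add: A_def gram_def)
  have limA: "(\<lambda>N. A N $$ (i, j)) \<longlonglongrightarrow> (if i = j then complex_of_real (d j) else 0)" if "i < K" "j < K" for i j
    using limG[OF that] that by (simp add: A_def)
  have d0: "complex_of_real (d i) \<noteq> 0" if "i < K" for i using d[OF that] by simp
  have det: "eventually (\<lambda>N. Determinant.det (A N) \<noteq> 0) sequentially"
    by (rule tendsto_minv_diag(1)[OF A limA d0])
  have limP: "(\<lambda>N. minv (A N) $$ (i, j)) \<longlonglongrightarrow> (if i = j then 1 / complex_of_real (d j) else 0)"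
    if "i < K" "j < K" for i j
    by (rule tendsto_minv_diag(2)[OF A limA d0 that])
  let ?z = "\<lambda>N i j. \<Sum>m<K. minv (A N) $$ (k, m) * (col_inner (G N l) (Et N i) m j / complex_of_real (sqrt (real N)))"
  let ?f = "\<lambda>N. \<alpha>\<^sup>2 * E / (\<alpha>\<^sup>2 * E * (\<Sum>i\<in>{..<L} - {l}. (r i k)\<^sup>2)
     + E * (\<Sum>i<L. \<Sum>j<K. (cmod (?z N i j))\<^sup>2) + Re (minv (A N) $$ (k, k)))"
  have "(\<lambda>N. ?z N i j) \<longlonglongrightarrow> (\<Sum>m<K. (if k = m then 1 / complex_of_real (d m) else 0) * 0)" if "i < L" "j < K" for i j
    using that k by (intro tendsto_sum tendsto_mult limP limE) auto
  then have z: "(\<lambda>N. ?z N i j) \<longlonglongrightarrow> 0" if "i < L" "j < K" for i j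
    using that by simp
  have "(\<lambda>N. \<Sum>i<L. \<Sum>j<K. (cmod (?z N i j))\<^sup>2) \<longlonglongrightarrow> (\<Sum>i<L. \<Sum>j<K. (cmod 0)\<^sup>2)"
    by (intro tendsto_sum tendsto_power tendsto_norm z) auto
  then have noise: "(\<lambda>N. \<Sum>i<L. \<Sum>j<K. (cmod (?z N i j))\<^sup>2) \<longlonglongrightarrow> 0" by simp
  have "(\<lambda>N. Re (minv (A N) $$ (k, k))) \<longlonglongrightarrow> Re (if k = k then 1 / complex_of_real (d k) else 0)"
    by (intro tendsto_Re limP k)
  then have Pkk: "(\<lambda>N. Re (minv (A N) $$ (k, k))) \<longlonglongrightarrow> 1 / d k" by simp
  have "0 \<le> \<alpha>\<^sup>2 * E * (\<Sum>i\<in>{..<L} - {l}. (r i k)\<^sup>2)"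
    using E by (simp add: sum_nonneg)
  moreover have "0 < 1 / d k" using d[OF k] by simp
  \<comment> \<open>The positive noise term 1 / d_k keeps the limiting denominator away from
    zero.\<close>
  ultimately have "\<alpha>\<^sup>2 * E * (\<Sum>i\<in>{..<L} - {l}. (r i k)\<^sup>2) + E * 0 + 1 / d k \<noteq> 0" by linarith
  then have "?f \<longlonglongrightarrow> \<alpha>\<^sup>2 * E / (\<alpha>\<^sup>2 * E * (\<Sum>i\<in>{..<L} - {l}. (r i k)\<^sup>2) + E * 0 + 1 / d k)"
    by (intro tendsto_divide tendsto_add tendsto_mult tendsto_const noise Pkk)
  moreover have "eventually (\<lambda>N. ?f N = sinr L (E / sqrt (real N)) \<alpha> l k (G N) (Et N)) sequentially"
    using det eventually_ge_at_top[of "max 1 K"]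
  proof eventually_elim
    case (elim N)
    then have N: "N \<ge> K" "N \<ge> 1" by auto
    interpret zero_forcing "G N l" N K k "sqrt (real N)"
      using elim N k G[OF N(1)] by unfold_locales (auto simp: A_gram)
    show ?case
      unfolding A_gram[OF N(1)] by (rule sinr_eq[symmetric]) (use l N Gi Et in auto)
  qed
  ultimately have "(\<lambda>N. sinr L (E / sqrt (real N)) \<alpha> l k (G N) (Et N)) \<longlonglongrightarrow>
    \<alpha>\<^sup>2 * E / (\<alpha>\<^sup>2 * E * (\<Sum>i\<in>{..<L} - {l}. (r i k)\<^sup>2) + E * 0 + 1 / d k)"
    by (rule Lim_transform_eventually)
  then show ?thesis by simp
qed

section \<open>The power-scaling law\<close>

text \<open>Both upper bounds come from dropping part of the denominator. The strict one makes the
  error variances positive when |\<alpha>| \<le> 1; the last one yields the 1 / sqrt N decay of the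
  estimated variances.\<close>

lemma beta_hat_bounds:
  assumes pos: "\<And>i. i < L \<Longrightarrow> \<beta> l i j > 0" and i: "i < L" and p: "p > 0"
  shows "0 < beta_hat L p \<beta> l i j" "beta_hat L p \<beta> l i j < \<beta> l i j"
    "beta_hat L p \<beta> l i j \<le> (\<beta> l i j)\<^sup>2 * p"
proof -
  let ?S = "\<Sum>i'<L. \<beta> l i' j"
  have le: "\<beta> l i j \<le> ?S"
    using pos i by (intro member_le_sum) (auto intro: less_imp_le)
  have b: "\<beta> l i j > 0" using pos[OF i] .
  have "1 / p > 0" using p by simp
  then have D: "?S + 1 / p > 0" "\<beta> l i j < ?S + 1 / p" using le b by linarith+
  then show "0 < beta_hat L p \<beta> l i j" using b by (simp add: beta_hat_def)
  have "\<beta> l i j * \<beta> l i j < \<beta> l i j * (?S + 1 / p)" using b D by (intro mult_strict_left_mono)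
  then show "beta_hat L p \<beta> l i j < \<beta> l i j"
    using D by (simp add: beta_hat_def pos_divide_less_eq power2_eq_square)
  have "(\<beta> l i j)\<^sup>2 / (?S + 1 / p) \<le> (\<beta> l i j)\<^sup>2 / (1 / p)"
    using le b p D by (intro divide_left_mono mult_pos_pos) auto
  then show "beta_hat L p \<beta> l i j \<le> (\<beta> l i j)\<^sup>2 * p"
    by (simp add: beta_hat_def)
qed

text \<open>At vanishing pilot power the term 1 / p_tr = sqrt N / e dominates the fixed sum in the
  denominator.\<close>

lemma beta_hat_scaled_tendsto:
  assumes e: "e > 0"
  shows "(\<lambda>N. sqrt (real N) * beta_hat L (e / sqrt (real N)) \<beta> l i j) \<longlonglongrightarrow> (\<beta> l i j)\<^sup>2 * e"
proof -
  define S where "S = (\<Sum>i'<L. \<beta> l i' j)"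
  have "(\<lambda>N. (\<beta> l i j)\<^sup>2 / (S * (1 / sqrt (real N)) + 1 / e)) \<longlonglongrightarrow> (\<beta> l i j)\<^sup>2 / (S * 0 + 1 / e)"
    using e by (intro tendsto_divide tendsto_add tendsto_mult tendsto_const) (real_asymp, simp)
  then have lim: "(\<lambda>N. (\<beta> l i j)\<^sup>2 / (S * (1 / sqrt (real N)) + 1 / e)) \<longlonglongrightarrow> (\<beta> l i j)\<^sup>2 * e"
    by simp
  show ?thesis
  proof (rule Lim_transform_eventually[OF lim])
    show "eventually (\<lambda>N. (\<beta> l i j)\<^sup>2 / (S * (1 / sqrt (real N)) + 1 / e)
        = sqrt (real N) * beta_hat L (e / sqrt (real N)) \<beta> l i j) sequentially"
      using eventually_gt_at_top[of 0]
    proof eventually_elim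
      case (elim N)
      have "S + 1 / (e / sqrt (real N)) = sqrt (real N) * (S * (1 / sqrt (real N)) + 1 / e)"
        using elim by (simp add: distrib_left)
      then show ?case
        using elim unfolding beta_hat_def S_def[symmetric] by simp
    qed
  qed
qed

lemma indep_gaussian_columnsD:
  assumes "prob_space M" "indep_gaussian_columns M n m S X"
  shows "X \<in> M \<rightarrow>\<^sub>M mat_borel n m"
    and "\<And>\<omega>. \<omega> \<in> space M \<Longrightarrow> X \<omega> \<in> carrier_mat n m"
    and "\<And>j. j < m \<Longrightarrow> (\<lambda>\<omega>. Matrix.col (X \<omega>) j) \<in> M \<rightarrow>\<^sub>M vec_borel n"
    and "\<And>j. j < m \<Longrightarrow> distr M (vec_borel n) (\<lambda>\<omega>. Matrix.col (X \<omega>) j) = CN n (S j)"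
    and "\<And>i j. i < m \<Longrightarrow> j < m \<Longrightarrow> i \<noteq> j \<Longrightarrow> prob_space.indep_var M (vec_borel n) (\<lambda>\<omega>. Matrix.col (X \<omega>) i)
      (vec_borel n) (\<lambda>\<omega>. Matrix.col (X \<omega>) j)"
proof -
  interpret prob_space M by fact
  show X: "X \<in> M \<rightarrow>\<^sub>M mat_borel n m"
    using assms(2) by (simp add: indep_gaussian_columns_def)
  show "X \<omega> \<in> carrier_mat n m" if "\<omega> \<in> space M" for \<omega>
    using measurable_space[OF X that] by simp
  show "(\<lambda>\<omega>. Matrix.col (X \<omega>) j) \<in> M \<rightarrow>\<^sub>M vec_borel n" if "j < m" for j
    by (rule measurable_compose[OF X measurable_col[OF that]])
  show "distr M (vec_borel n) (\<lambda>\<omega>. Matrix.col (X \<omega>) j) = CN n (S j)" if "j < m" for j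
    using assms(2) that by (simp add: indep_gaussian_columns_def)
  show "indep_var (vec_borel n) (\<lambda>\<omega>. Matrix.col (X \<omega>) i) (vec_borel n) (\<lambda>\<omega>. Matrix.col (X \<omega>) j)"
    if "i < m" "j < m" "i \<noteq> j" for i j
    using assms(2) that indep_var_of_indep_vars[of "\<lambda>_. vec_borel n" "\<lambda>j \<omega>. Matrix.col (X \<omega>) j" "{..<m}" i j]
    by (simp add: indep_gaussian_columns_def)
qed

lemma col_inner_eq_sum_col:
  assumes "A \<in> carrier_mat n m" "B \<in> carrier_mat n m'" "i < m" "j < m'"
  shows "col_inner A B i j = (\<Sum>r<n. cnj (Matrix.col A i $ r) * Matrix.col B j $ r)"
  using assms by (auto simp: col_inner_def intro!: sum.cong)

theorem mainTheorem7:
  fixes M :: "'w measure"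
    and L K \<tau> l k :: nat
    and \<alpha> E :: real
    and \<beta> :: "nat \<Rightarrow> nat \<Rightarrow> nat \<Rightarrow> real"
    and G Et :: "nat \<Rightarrow> nat \<Rightarrow> 'w \<Rightarrow> complex mat"
  assumes "prob_space M"
    and "L \<ge> 2" and "K \<ge> 1" and "\<tau> \<ge> K"
    and "l < L" and "k < K"
    and "0 < \<bar>\<alpha>\<bar>" and "\<bar>\<alpha>\<bar> \<le> 1"
    and "E > 0"
    and "\<And>i j. i < L \<Longrightarrow> j < K \<Longrightarrow> \<beta> l i j > 0"
    and "\<And>N. N \<ge> K \<Longrightarrow> channel_model M L K N \<tau> (E / sqrt (real N)) \<beta> \<alpha> l (G N) (Et N)"
  shows "AE \<omega> in M.
    (\<lambda>N. sinr L (E / sqrt (real N)) \<alpha> l k (\<lambda>i. G N i \<omega>) (\<lambda>i. Et N i \<omega>))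
      \<longlonglongrightarrow> \<alpha>\<^sup>2 * real \<tau> * E\<^sup>2 * (\<beta> l l k)\<^sup>2 /
        (\<alpha>\<^sup>2 * real \<tau> * E\<^sup>2 * interf_const L \<beta> l k * (\<beta> l l k)\<^sup>2 + 1)"
proof -
  interpret prob_space M by fact
  note l = \<open>l < L\<close> and k = \<open>k < K\<close> and E = \<open>E > 0\<close> and pos = assms(10)
  \<comment> \<open>The pilot power is e / sqrt N, so the estimated variances are governed by
    \<open>e\<close> alone.\<close>
  define e where "e = real \<tau> * E"
  have e: "e > 0" using assms(3,4) E by (simp add: e_def)
  define bh where "bh N = beta_hat L (e / sqrt (real N)) \<beta>" for N
  define c where "c N j = bh N l l j" for N j
  define c' where "c' N i j = \<beta> l i j - \<alpha>\<^sup>2 * bh N l i j" for N i j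
  define d where "d j = (\<beta> l l j)\<^sup>2 * e" for j
  have p: "e / sqrt (real N) > 0" if "N \<ge> K" for N using e that \<open>K \<ge> 1\<close> by simp
  have d: "d j > 0" if "j < K" for j using pos[OF l that] e by (simp add: d_def)
  have c: "c N j > 0" "c N j \<le> d j / sqrt (real N)" if "N \<ge> K" "j < K" for N j
    using beta_hat_bounds[of L \<beta> l j l "e / sqrt (real N)"] pos l p that by (auto simp: c_def bh_def d_def)
  \<comment> \<open>For two different estimated columns, one variance enters through its decay and
    the other through this constant bound.\<close>
  have c_le: "c N j \<le> d j" if "N \<ge> K" "j < K" for N j
  proof -
    have "1 \<le> sqrt (real N)" using that \<open>K \<ge> 1\<close> by simp
    then have "d j / sqrt (real N) \<le> d j / 1" using d[OF that(2)] by (intro divide_left_mono) auto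
    then show ?thesis using c(2)[OF that] by simp
  qed
  have c': "c' N i j > 0" "c' N i j \<le> \<beta> l i j" if "N \<ge> K" "i < L" "j < K" for N i j
  proof -
    have b: "0 < bh N l i j" "bh N l i j < \<beta> l i j"
      using beta_hat_bounds[of L \<beta> l j i "e / sqrt (real N)"] pos p that by (auto simp: bh_def)
    have "\<alpha>\<^sup>2 \<le> 1" using \<open>\<bar>\<alpha>\<bar> \<le> 1\<close> by (simp add: abs_square_le_1)
    then have "\<alpha>\<^sup>2 * bh N l i j \<le> bh N l i j" using b by (simp add: mult_left_le_one_le)
    then show "c' N i j > 0" using b unfolding c'_def by linarith
    show "c' N i j \<le> \<beta> l i j" using b by (simp add: c'_def)
  qed
  have cm: "indep_gaussian_columns M N K (\<lambda>j. scalar_cov N (c N j)) (G N l)"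
    "i < L \<Longrightarrow> i \<noteq> l \<Longrightarrow> \<omega> \<in> space M \<Longrightarrow>
      G N i \<omega> = G N l \<omega> * mat_diag K (\<lambda>j. complex_of_real (\<beta> l i j / \<beta> l l j))"
    "i < L \<Longrightarrow> indep_gaussian_columns M N K (\<lambda>j. scalar_cov N (c' N i j)) (Et N i)"
    "indep_set (sets (vimage_algebra (space M) (G N l) (mat_borel N K)))
       (sets (vimage_algebra (space M) (\<lambda>\<omega>. \<lambda>i\<in>{..<L}. Et N i \<omega>) (\<Pi>\<^sub>M i\<in>{..<L}. mat_borel N K)))"
    if "N \<ge> K" for N i \<omega>
    using assms(11)[OF that]
    by (simp_all only: channel_model_def Let_def c_def c'_def bh_def e_def times_divide_eq_right simp_thms)
  note Gcol = indep_gaussian_columnsD[OF \<open>prob_space M\<close> cm(1)]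
  note Ecol = indep_gaussian_columnsD[OF \<open>prob_space M\<close> cm(3)]
  have indepE: "indep_var (vec_borel N) (\<lambda>\<omega>. Matrix.col (G N l \<omega>) m) (vec_borel N) (\<lambda>\<omega>. Matrix.col (Et N i \<omega>) j)"
    if "N \<ge> K" "i < L" "m < K" "j < K" for N i m j
  proof -
    \<comment> \<open>A single error column is a measurable function of the whole tuple of error
      matrices: project to i, then take column j.\<close>
    have "indep_var (vec_borel N) (\<lambda>\<omega>. Matrix.col (G N l \<omega>) m)
        (vec_borel N) (\<lambda>\<omega>. Matrix.col ((\<lambda>i\<in>{..<L}. Et N i \<omega>) i) j)"
    proof (rule indep_var_of_indep_set_vimage[OF cm(4)[OF that(1)],
          where f = "\<lambda>A. Matrix.col A m" and g = "\<lambda>y. Matrix.col (y i) j"])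
      show "random_variable (mat_borel N K) (G N l)" by (rule Gcol(1)[OF that(1)])
      show "random_variable (\<Pi>\<^sub>M i\<in>{..<L}. mat_borel N K) (\<lambda>\<omega>. \<lambda>i\<in>{..<L}. Et N i \<omega>)"
        using Ecol(1)[OF that(1)] by (intro measurable_restrict) auto
      show "(\<lambda>A. Matrix.col A m) \<in> mat_borel N K \<rightarrow>\<^sub>M vec_borel N"
        by (rule measurable_col[OF that(3)])
      show "(\<lambda>y. Matrix.col (y i) j) \<in> (\<Pi>\<^sub>M i\<in>{..<L}. mat_borel N K) \<rightarrow>\<^sub>M vec_borel N"
        using that measurable_compose[OF measurable_component_singleton[of i "{..<L}" "\<lambda>_. mat_borel N K"]
          measurable_col[OF that(4)]] by simp
    qed
    then show ?thesis using that by simp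
  qed
  \<comment> \<open>Written through columns, where the Gaussian laws live. It agrees with scaled
    \<open>col_inner\<close> only for N \<ge> K, where the dimensions are known; hence the eventual
    equality \<open>z_eq\<close>.\<close>
  define z where "z A B i j = (\<lambda>N. (\<Sum>r<N. cnj (Matrix.col (A N) i $ r) * Matrix.col (B N) j $ r) / complex_of_real (sqrt (real N)))"
    for A B :: "nat \<Rightarrow> complex mat" and i j
  have AE_G: "AE \<omega> in M. z (\<lambda>N. G N l \<omega>) (\<lambda>N. G N l \<omega>) i j \<longlonglongrightarrow> (if i = j then complex_of_real (d j) else 0)"
    if ij: "i < K" "j < K" for i j
  proof (cases "i = j")
    case True
    have "(\<lambda>N. sqrt (real N) * c N j) \<longlonglongrightarrow> d j"
      unfolding c_def bh_def d_def by (rule beta_hat_scaled_tendsto[OF e])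
    then have "AE \<omega> in M. (\<lambda>N. (\<Sum>r<N. (cmod (Matrix.col (G N l \<omega>) j $ r))\<^sup>2) / sqrt (real N)) \<longlonglongrightarrow> d j"
      using ij by (intro AE_norm_CN_scaled_tendsto[of K _ "\<lambda>N. c N j"] Gcol(3,4) c(1)) auto
    then show ?thesis
    proof eventually_elim
      case (elim \<omega>)
      have "(\<lambda>N. complex_of_real ((\<Sum>r<N. (cmod (Matrix.col (G N l \<omega>) j $ r))\<^sup>2) / sqrt (real N)))
          \<longlonglongrightarrow> complex_of_real (d j)"
        by (rule tendsto_of_real[OF elim])
      moreover have "z (\<lambda>N. G N l \<omega>) (\<lambda>N. G N l \<omega>) i j
          = (\<lambda>N. complex_of_real ((\<Sum>r<N. (cmod (Matrix.col (G N l \<omega>) j $ r))\<^sup>2) / sqrt (real N)))"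
        by (simp only: z_def True of_real_divide of_real_sum complex_norm_square mult.commute)
      ultimately show ?case using True by (simp only: if_True simp_thms)
    qed
  next
    case False
    then show ?thesis
      unfolding z_def using ij
      by (simp only: if_False)
        (intro AE_inner_CN_scaled_tendsto_0[of K _ _ "\<lambda>N. c N i" "\<lambda>N. c N j" "d i" "d j"] Gcol(4,5) c c_le; simp)
  qed
  have AE_E: "AE \<omega> in M. z (\<lambda>N. G N l \<omega>) (\<lambda>N. Et N i \<omega>) m j \<longlonglongrightarrow> 0"
    if "i < L" "m < K" "j < K" for i m j
    unfolding z_def using that
    by (intro AE_inner_CN_scaled_tendsto_0[of K _ _ "\<lambda>N. c N m" "\<lambda>N. c' N i j" "d m" "\<beta> l i j"] indepE Gcol(4) Ecol(4) c c'; simp)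
  \<comment> \<open>K and L are fixed, so finitely many null sets combine into one.\<close>
  have "AE \<omega> in M. \<forall>i\<in>{..<K}. \<forall>j\<in>{..<K}.
      z (\<lambda>N. G N l \<omega>) (\<lambda>N. G N l \<omega>) i j \<longlonglongrightarrow> (if i = j then complex_of_real (d j) else 0)"
    using AE_G by (simp add: AE_finite_all)
  moreover have "AE \<omega> in M. \<forall>i\<in>{..<L}. \<forall>m\<in>{..<K}. \<forall>j\<in>{..<K}. z (\<lambda>N. G N l \<omega>) (\<lambda>N. Et N i \<omega>) m j \<longlonglongrightarrow> 0"
    using AE_E by (simp add: AE_finite_all)
  ultimately show ?thesis
    using AE_space
  proof eventually_elim
    case (elim \<omega>)
    have z_eq: "eventually (\<lambda>N. z A B i j N = col_inner (A N) (B N) i j / complex_of_real (sqrt (real N))) sequentially"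
      if "\<And>N. N \<ge> K \<Longrightarrow> A N \<in> carrier_mat N K" "\<And>N. N \<ge> K \<Longrightarrow> B N \<in> carrier_mat N K" "i < K" "j < K" for A B i j
      using eventually_ge_at_top[of K]
    proof eventually_elim
      case (elim N)
      show ?case
        unfolding z_def col_inner_eq_sum_col[OF that(1)[OF elim] that(2)[OF elim] that(3,4)] ..
    qed
    have "(\<lambda>N. sinr L (E / sqrt (real N)) \<alpha> l k (\<lambda>i. G N i \<omega>) (\<lambda>i. Et N i \<omega>)) \<longlonglongrightarrow>
        \<alpha>\<^sup>2 * E / (\<alpha>\<^sup>2 * E * (\<Sum>i\<in>{..<L} - {l}. (\<beta> l i k / \<beta> l l k)\<^sup>2) + 1 / d k)"
    proof (rule sinr_tendsto[where G = "\<lambda>N i. G N i \<omega>" and Et = "\<lambda>N i. Et N i \<omega>" and r = "\<lambda>i j. \<beta> l i j / \<beta> l l j"])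
      fix i j assume "i < K" "j < K"
      then show "(\<lambda>N. col_inner (G N l \<omega>) (G N l \<omega>) i j / complex_of_real (sqrt (real N)))
          \<longlonglongrightarrow> (if i = j then complex_of_real (d j) else 0)"
        using elim Gcol(2) by (intro Lim_transform_eventually[OF _ z_eq]) auto
    next
      fix i m j assume "i < L" "m < K" "j < K"
      then show "(\<lambda>N. col_inner (G N l \<omega>) (Et N i \<omega>) m j / complex_of_real (sqrt (real N))) \<longlonglongrightarrow> 0"
        using elim Gcol(2) Ecol(2) by (intro Lim_transform_eventually[OF _ z_eq]) auto
    qed (use k l E d Gcol(2) Ecol(2) cm(2) elim in auto)
    \<comment> \<open>Multiplication by d_k clears the noise term 1 / d_k, and E d_k = tau E^2
      beta_llk^2 produces the square of E in the claim.\<close>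
    also have "\<alpha>\<^sup>2 * E / (\<alpha>\<^sup>2 * E * (\<Sum>i\<in>{..<L} - {l}. (\<beta> l i k / \<beta> l l k)\<^sup>2) + 1 / d k)
        = \<alpha>\<^sup>2 * E * d k / (\<alpha>\<^sup>2 * E * (\<Sum>i\<in>{..<L} - {l}. (\<beta> l i k / \<beta> l l k)\<^sup>2) * d k + 1)"
    proof -
      have "\<alpha>\<^sup>2 * E * (\<Sum>i\<in>{..<L} - {l}. (\<beta> l i k / \<beta> l l k)\<^sup>2) + 1 / d k
          = (\<alpha>\<^sup>2 * E * (\<Sum>i\<in>{..<L} - {l}. (\<beta> l i k / \<beta> l l k)\<^sup>2) * d k + 1) / d k"
        using d[OF k] by (simp add: add_divide_distrib)
      then show ?thesis by simp
    qed
    also have "\<dots> = \<alpha>\<^sup>2 * real \<tau> * E\<^sup>2 * (\<beta> l l k)\<^sup>2 /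
        (\<alpha>\<^sup>2 * real \<tau> * E\<^sup>2 * interf_const L \<beta> l k * (\<beta> l l k)\<^sup>2 + 1)"
      by (simp add: d_def e_def interf_const_def power2_eq_square mult_ac)
    finally show ?case .
  qed
qed

end
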